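(* For every $n\in\mathbb{N}$ and every $A,B\in\mathbb{M}_n^+$ with $B>0$, \begin{align*} \mathrm{Tr}\,AB^{-1}A(\log A-\log B) &\le\mathrm{Tr}\,A^{1/2}B^{-1}A^{3/2}\log(A^{1/2}B^{-1}A^{1/2})\\ &=\mathrm{Tr}\,B^{-1/2}A^2B^{-1/2}\log(B^{-1/2}AB^{-1/2})\\ &=\mathrm{Tr}\,A^{3/2}B^{-1}A^{1/2}\log(A^{1/2}B^{-1}A^{1/2})\\ &\le\mathrm{Tr}\,A^2B^{-1}(\log A-\log B). \end{align*}
   Context: $\mathbb{M}_n^+$ is the set of positive semidefinite $n\times n$ complex matrices, and $B>0$ means that $B$ is positive definite. $\mathrm{Tr}$ is the usual trace, and in each expression it applies to the whole product that follows it. For a singular positive semidefinite matrix $X$, $\log X$ is defined by functional calculus with the convention $\log 0:=0$ (i.e., $\log X$ is taken on the support of $X$ and is zero on its kernel); with this convention each of the trace expressions in the claim is the limit of the same expression with $A$ replaced by $A+\varepsilon I$ as $\varepsilon\searrow0$. *)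

theory Defs
  imports
    "Jordan_Normal_Form.Gauss_Jordan_Elimination"
    "Jordan_Normal_Form.Schur_Decomposition"
begin

definition mat_trace :: "complex mat \<Rightarrow> complex" where
  "mat_trace A = (\<Sum>i<dim_row A. A $$ (i, i))"

definition unitary_mat :: "nat \<Rightarrow> complex mat \<Rightarrow> bool" where
  "unitary_mat n U \<longleftrightarrow> U \<in> carrier_mat n n \<and>
     mat_adjoint U * U = 1\<^sub>m n \<and> U * mat_adjoint U = 1\<^sub>m n"

(* The order on complex numbers is the one of HOL-Library.Complex_Order: 0 <= z and 0 < z
   include the requirement that z is real. *)

definition psd_mat :: "nat \<Rightarrow> complex mat \<Rightarrow> bool" where
  "psd_mat n A \<longleftrightarrow> A \<in> carrier_mat n n \<and> mat_adjoint A = A \<and>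
     (\<forall>v\<in>carrier_vec n. 0 \<le> (A *\<^sub>v v) \<bullet>c v)"

definition pd_mat :: "nat \<Rightarrow> complex mat \<Rightarrow> bool" where
  "pd_mat n A \<longleftrightarrow> A \<in> carrier_mat n n \<and> mat_adjoint A = A \<and>
     (\<forall>v\<in>carrier_vec n. v \<noteq> 0\<^sub>v n \<longrightarrow> 0 < (A *\<^sub>v v) \<bullet>c v)"

(* mat_inverse yields None on singular matrices, where mat_inv is unspecified. *)

definition mat_inv :: "complex mat \<Rightarrow> complex mat" where
  "mat_inv A = the (mat_inverse A)"

definition unitary_diag :: "nat \<Rightarrow> complex mat \<Rightarrow> (nat \<Rightarrow> real) \<Rightarrow> complex mat" where
  "unitary_diag n U d = U * mat_diag n (\<lambda>i. complex_of_real (d i)) * mat_adjoint U"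

(* Functional calculus of a Hermitian matrix A = U diag(d) U* as f(A) = U diag(f o d) U*. The
   value does not depend on the chosen diagonalization (mat_fun_unitary_diag below); one exists
   by the spectral theorem. If A is not Hermitian, the value is unspecified. *)

definition mat_fun :: "(real \<Rightarrow> real) \<Rightarrow> complex mat \<Rightarrow> complex mat" where
  "mat_fun f A = (THE C. \<exists>U d. unitary_mat (dim_row A) U \<and>
     A = unitary_diag (dim_row A) U d \<and> C = unitary_diag (dim_row A) U (\<lambda>i. f (d i)))"

(* For positive semidefinite matrices only; 0 powr p = 0 for every p, so a negative p requires
   a positive definite matrix. *)

definition mat_powr :: "complex mat \<Rightarrow> real \<Rightarrow> complex mat" where
  "mat_powr A p = mat_fun (\<lambda>x. x powr p) A"

definition mat_log :: "complex mat \<Rightarrow> complex mat" where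
  "mat_log A = mat_fun (\<lambda>x. if x = 0 then 0 else ln x) A"

lemma mat_adjoint_carrier: "A \<in> carrier_mat n m \<Longrightarrow> mat_adjoint A \<in> carrier_mat m n"
  unfolding mat_adjoint_def by auto

lemma unitary_diag_cong:
  assumes U: "unitary_mat n U" and V: "unitary_mat n V"
    and eq: "unitary_diag n U d = unitary_diag n V e"
  shows "unitary_diag n U (\<lambda>i. f (d i)) = unitary_diag n V (\<lambda>i. f (e i))"
proof -
  let ?D = "\<lambda>d. mat_diag n (\<lambda>i. complex_of_real (d i))"
  let ?U = "mat_adjoint U" and ?V = "mat_adjoint V"
  have c [simp]: "U \<in> carrier_mat n n" "V \<in> carrier_mat n n"
    "?U \<in> carrier_mat n n" "?V \<in> carrier_mat n n" "\<And>d. ?D d \<in> carrier_mat n n"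
    using U V by (auto simp: unitary_mat_def intro: mat_adjoint_carrier)
  have u: "?U * U = 1\<^sub>m n" "U * ?U = 1\<^sub>m n" "?V * V = 1\<^sub>m n" "V * ?V = 1\<^sub>m n"
    using U V by (auto simp: unitary_mat_def)
  note mc = mult_carrier_mat[of _ n n _ n]
  note assoc = assoc_mult_mat[of _ n n _ n _ n]
  note c' = c mc left_mult_one_mat[of _ n n] right_mult_one_mat[of _ n n]
  define W where "W = ?V * U"
  have W: "W \<in> carrier_mat n n" unfolding W_def by (rule mult_carrier_mat[OF c(4) c(1)])
  have l: "?V * unitary_diag n U g * U = W * ?D g" for g
  proof -
    have "?V * unitary_diag n U g * U = ?V * U * ?D g * (?U * U)"
      unfolding unitary_diag_def by (simp only: assoc c mc)
    thus ?thesis unfolding u W_def by (simp only: c')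
  qed
  have r: "?V * unitary_diag n V g * U = ?D g * W" for g
  proof -
    have "?V * unitary_diag n V g * U = (?V * V) * ?D g * (?V * U)"
      unfolding unitary_diag_def by (simp only: assoc c mc)
    thus ?thesis unfolding u W_def by (simp only: c')
  qed
  have WD: "(W * ?D g) $$ (i, j) = W $$ (i, j) * g j"
    and DW: "(?D g * W) $$ (i, j) = g i * W $$ (i, j)" if "i < n" "j < n" for g i j
    using that by (simp_all add: mat_diag_mult_right[OF W] mat_diag_mult_left[OF W])
  have comm: "W * ?D d = ?D e * W" using l r eq by metis
  have "W * ?D (\<lambda>i. f (d i)) = ?D (\<lambda>i. f (e i)) * W"
  proof (rule eq_matI)
    fix i j
    assume "i < dim_row (?D (\<lambda>i. f (e i)) * W)" "j < dim_col (?D (\<lambda>i. f (e i)) * W)"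
    hence ij: "i < n" "j < n" using W by (auto simp: mat_diag_def)
    have "W $$ (i, j) * d j = e i * W $$ (i, j)" using comm WD[OF ij] DW[OF ij] by metis
    hence "W $$ (i, j) = 0 \<or> d j = e i" by auto
    thus "(W * ?D (\<lambda>i. f (d i))) $$ (i, j) = (?D (\<lambda>i. f (e i)) * W) $$ (i, j)"
      unfolding WD[OF ij] DW[OF ij] by auto
  qed (use W in \<open>auto simp: mat_diag_def\<close>)
  hence *: "?V * unitary_diag n U (\<lambda>i. f (d i)) * U = ?V * unitary_diag n V (\<lambda>i. f (e i)) * U"
    unfolding l r .
  have cancel: "V * (?V * X * U) * ?U = X" if "X \<in> carrier_mat n n" for X
  proof -
    have "V * (?V * X * U) * ?U = (V * ?V) * X * (U * ?U)"
      by (simp only: assoc c mc that)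
    thus ?thesis unfolding u by (simp only: c' that)
  qed
  have "unitary_diag n U g \<in> carrier_mat n n" "unitary_diag n V g \<in> carrier_mat n n" for g
    unfolding unitary_diag_def by (simp_all only: c mc)
  thus ?thesis using * cancel by metis
qed

lemma mat_fun_unitary_diag:
  assumes U: "unitary_mat n U"
  shows "mat_fun f (unitary_diag n U d) = unitary_diag n U (\<lambda>i. f (d i))"
proof -
  have dim: "dim_row (unitary_diag n U d) = n"
    using U by (auto simp: unitary_diag_def unitary_mat_def)
  show ?thesis unfolding mat_fun_def dim
  proof (rule the_equality)
    show "\<exists>V e. unitary_mat n V \<and> unitary_diag n U d = unitary_diag n V e \<and>
        unitary_diag n U (\<lambda>i. f (d i)) = unitary_diag n V (\<lambda>i. f (e i))"
      using U by blast
  next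
    fix C
    assume "\<exists>V e. unitary_mat n V \<and> unitary_diag n U d = unitary_diag n V e \<and>
        C = unitary_diag n V (\<lambda>i. f (e i))"
    then obtain V e where V: "unitary_mat n V" "unitary_diag n U d = unitary_diag n V e"
      and C: "C = unitary_diag n V (\<lambda>i. f (e i))" by blast
    show "C = unitary_diag n U (\<lambda>i. f (d i))"
      unfolding C by (rule unitary_diag_cong[OF U V, symmetric])
  qed
qed

end

theory Submission
  imports Defs "Jordan_Normal_Form.Spectral_Radius" "HOL-Analysis.L2_Norm"
begin

text \<open>
  Write \<open>E = B\<^sup>-\<^sup>1\<close>, \<open>D = E\<^sup>1\<^sup>/\<^sup>2 A E\<^sup>1\<^sup>/\<^sup>2\<close> and \<open>K = A E A\<close>. The two equalities are a matter of functional
  calculus: for \<open>Z = A\<^sup>1\<^sup>/\<^sup>2 E\<^sup>1\<^sup>/\<^sup>2\<close> the two logarithms are \<open>log (Z Z\<^sup>*)\<close> and \<open>log (Z\<^sup>* Z)\<close>, and \<open>Z\<close> intertwines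
  them (\<open>functional_calculus_intertwine\<close>), so that all three traces are cyclic permutations of each
  other.

  For the inequalities, diagonalize \<open>D\<close> with eigenvalues \<open>d\<^sub>m\<close> and eigenvectors \<open>w\<^sub>m\<close> and put
  \<open>g\<^sub>m = B\<^sup>1\<^sup>/\<^sup>2 w\<^sub>m\<close>. Then, as sums of rank one matrices,
  \<open>B = \<Sum> g\<^sub>m g\<^sub>m\<^sup>*\<close>, \<open>A = \<Sum> d\<^sub>m g\<^sub>m g\<^sub>m\<^sup>*\<close> and \<open>K = \<Sum> d\<^sub>m\<^sup>2 g\<^sub>m g\<^sub>m\<^sup>*\<close>, and the common value of the middle traces is
  \<open>M = \<Sum> |g\<^sub>m|\<^sup>2 d\<^sub>m\<^sup>2 log d\<^sub>m\<close>. The analytic tool is the quantity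
  \<open>F\<^sub>t(A, B) = \<langle>A, (L\<^sub>A + t R\<^sub>B)\<^sup>-\<^sup>1 A\<rangle>\<close> for \<open>t > 0\<close>, where \<open>L\<^sub>A\<close> is left multiplication by \<open>A\<close>, \<open>R\<^sub>B\<close> is right
  multiplication by \<open>B\<close> and the inner product is that of Hilbert and Schmidt. It is the maximum over
  \<open>Y\<close> of \<open>2 Re Tr A Y - Tr A Y Y\<^sup>* - t Tr B Y\<^sup>* Y\<close>. Inserting the maximizer and a rank one decomposition as
  above bounds \<open>F\<^sub>t(A, B)\<close> by its value on the commuting pieces, \<open>\<Sum> |g\<^sub>m|\<^sup>2 d\<^sub>m\<^sup>2 / (d\<^sub>m + t)\<close>
  (\<open>quasi_entropy_reverse_test\<close>); inserting a \<open>Y\<close> that is diagonal in some orthonormal basis bounds it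
  from below by the same expression for the diagonals of the two matrices in that basis
  (\<open>quasi_entropy_measured\<close>). Because \<open>\<Sum> w\<^sub>i log (x\<^sub>i + t)\<close> has derivative \<open>\<Sum> w\<^sub>i / (x\<^sub>i + t)\<close>, a comparison
  of the latter sums for all \<open>t > 0\<close> gives a comparison of logarithmic sums
  (\<open>weighted_ln_le_of_resolvent_le\<close>), in opposite directions for \<open>x log x\<close> and for \<open>x\<^sup>2 log x\<close>.

  The right inequality is the bound on \<open>F\<^sub>t(A, B)\<close> by pieces, read for \<open>x\<^sup>2 log x\<close>
  (\<open>square_log_ge_reverse_test\<close>). For the left one, the pieces \<open>h\<^sub>m = d\<^sub>m\<^sup>1\<^sup>/\<^sup>2 g\<^sub>m\<close> decompose
  \<open>A = \<Sum> h\<^sub>m h\<^sub>m\<^sup>*\<close> and \<open>K = \<Sum> d\<^sub>m h\<^sub>m h\<^sub>m\<^sup>*\<close>, and the bound for \<open>x log x\<close> says that the relative entropy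
  \<open>Tr K (log K - log A)\<close> is at most \<open>\<Sum> d\<^sub>m |h\<^sub>m|\<^sup>2 log d\<^sub>m = M\<close> (\<open>relative_entropy_le_reverse_test\<close>). It
  remains to see that \<open>Tr K (log A - log B) \<le> Tr K (log K - log A)\<close>, that is,
  \<open>Tr K (log K - log A\<^sup>2) \<ge> Tr K log E\<close>. Measuring \<open>K\<close> and \<open>A\<^sup>2\<close> in the eigenbasis of \<open>B\<close> decreases the
  relative entropy on the left, and then the claim is the scalar inequality \<open>log x \<le> x - 1\<close> together with
  \<open>Tr K = Tr A\<^sup>2 E\<close> (\<open>log_difference_le_relative_entropy\<close>).

  If \<open>A\<close> is singular, every term in which a logarithm of zero occurs has weight zero.
\<close>

section \<open>Adjoints, traces and unitary matrices\<close>

lemma mat_adjoint_index: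
  assumes "A \<in> carrier_mat n m" "i < m" "j < n"
  shows "mat_adjoint A $$ (i, j) = cnj (A $$ (j, i))"
  using assms unfolding mat_adjoint_def by (auto simp: mat_of_rows_index)

lemma mat_adjoint_adjoint:
  assumes A: "A \<in> carrier_mat n m"
  shows "mat_adjoint (mat_adjoint A) = (A :: complex mat)"
proof (rule eq_matI)
  note A' = mat_adjoint_carrier[OF A]
  show "dim_row (mat_adjoint (mat_adjoint A)) = dim_row A" "dim_col (mat_adjoint (mat_adjoint A)) = dim_col A"
    using mat_adjoint_carrier[OF A'] A by auto
  fix i j assume "i < dim_row A" "j < dim_col A"
  hence ij: "i < n" "j < m" using A by auto
  show "mat_adjoint (mat_adjoint A) $$ (i, j) = A $$ (i, j)"
    by (simp add: mat_adjoint_index[OF A' ij] mat_adjoint_index[OF A ij(2,1)])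
qed

lemma mat_mult_index:
  assumes "A \<in> carrier_mat n m" "B \<in> carrier_mat m p" "i < n" "j < p"
  shows "(A * B) $$ (i, j) = (\<Sum>k<m. A $$ (i, k) * B $$ (k, j))"
  using assms by (auto simp: scalar_prod_def atLeast0LessThan intro!: sum.cong)

lemma mat_adjoint_mult:
  assumes A: "A \<in> carrier_mat n m" and B: "B \<in> carrier_mat m p"
  shows "mat_adjoint (A * B) = mat_adjoint B * mat_adjoint (A :: complex mat)"
proof (rule eq_matI)
  fix i j assume "i < dim_row (mat_adjoint B * mat_adjoint A)" "j < dim_col (mat_adjoint B * mat_adjoint A)"
  hence ij: "i < p" "j < n" using A B by (auto simp: mat_adjoint_def)
  show "mat_adjoint (A * B) $$ (i, j) = (mat_adjoint B * mat_adjoint A) $$ (i, j)"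
    using ij by (simp add: mat_adjoint_index[OF mult_carrier_mat[OF A B]] mat_mult_index[OF A B]
        mat_mult_index[OF mat_adjoint_carrier[OF B] mat_adjoint_carrier[OF A]]
        mat_adjoint_index[OF A] mat_adjoint_index[OF B] mult.commute)
qed (use A B in \<open>auto simp: mat_adjoint_def\<close>)

lemma mat_adjoint_diag:
  "mat_adjoint (mat_diag n (\<lambda>i. complex_of_real (d i))) = mat_diag n (\<lambda>i. complex_of_real (d i))"
  by (rule eq_matI) (auto simp: mat_adjoint_index[OF mat_diag_dim] mat_diag_def mat_adjoint_def
    mat_of_rows_index)

lemma mat_trace_comm:
  assumes A: "A \<in> carrier_mat n m" and B: "B \<in> carrier_mat m n"
  shows "mat_trace (A * B) = mat_trace (B * A)"
proof -
  have "mat_trace (A * B) = (\<Sum>i<n. \<Sum>k<m. A $$ (i, k) * B $$ (k, i))"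
    unfolding mat_trace_def using A by (auto simp: mat_mult_index[OF A B] simp del: index_mult_mat(1))
  also have "\<dots> = (\<Sum>k<m. \<Sum>i<n. A $$ (i, k) * B $$ (k, i))" by (rule sum.swap)
  also have "\<dots> = mat_trace (B * A)"
    unfolding mat_trace_def using B
    by (auto simp: mat_mult_index[OF B A] mult.commute simp del: index_mult_mat(1))
  finally show ?thesis .
qed

lemma mat_trace_minus:
  assumes "X \<in> carrier_mat n n" "Y \<in> carrier_mat n n"
  shows "mat_trace (X - Y) = mat_trace X - mat_trace Y"
  using assms unfolding mat_trace_def by (simp add: sum_subtractf)

lemma adjoint_mult_self_index:
  assumes M: "M \<in> carrier_mat n m" and i: "i < m"
  shows "(mat_adjoint M * M) $$ (i, i) = complex_of_real (\<Sum>k<n. (cmod (M $$ (k, i)))\<^sup>2)"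
  using i by (simp add: mat_mult_index[OF mat_adjoint_carrier[OF M] M] mat_adjoint_index[OF M]
      complex_norm_square mult.commute del: of_real_power)

lemma unitary_matI:
  assumes "U \<in> carrier_mat n n" "mat_adjoint U * U = 1\<^sub>m n"
  shows "unitary_mat n U"
  using assms mat_mult_left_right_inverse[OF mat_adjoint_carrier[OF assms(1)] assms(1)]
  by (simp add: unitary_mat_def)

lemma unitary_matI':
  assumes "U \<in> carrier_mat n n" "U * mat_adjoint U = 1\<^sub>m n"
  shows "unitary_mat n U"
  using assms mat_mult_left_right_inverse[OF assms(1) mat_adjoint_carrier[OF assms(1)]]
  by (simp add: unitary_mat_def)

lemma unitary_carrier:
  assumes "unitary_mat n U"
  shows "U \<in> carrier_mat n n" "mat_adjoint U \<in> carrier_mat n n"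
  using assms by (auto simp: unitary_mat_def intro: mat_adjoint_carrier)

lemma unitary_cancel:
  assumes U: "unitary_mat n U" and X: "X \<in> carrier_mat n n"
  shows "U * (mat_adjoint U * X) = X" "mat_adjoint U * (U * X) = X"
proof -
  note c = unitary_carrier[OF U] X
  have "U * (mat_adjoint U * X) = (U * mat_adjoint U) * X"
    by (rule assoc_mult_mat[symmetric]) (rule c)+
  thus "U * (mat_adjoint U * X) = X" using U X by (simp add: unitary_mat_def)
  have "mat_adjoint U * (U * X) = (mat_adjoint U * U) * X"
    by (rule assoc_mult_mat[symmetric]) (rule c)+
  thus "mat_adjoint U * (U * X) = X" using U X by (simp add: unitary_mat_def)
qed

lemma unitary_mult:
  assumes U: "unitary_mat n U" and V: "unitary_mat n V"
  shows "unitary_mat n (U * V)"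
proof -
  note cU = unitary_carrier[OF U] and cV = unitary_carrier[OF V]
  note c = cU cV mult_carrier_mat[of _ n n _ n]
  note assoc = assoc_mult_mat[of _ n n _ n _ n]
  have a: "mat_adjoint (U * V) = mat_adjoint V * mat_adjoint U"
    by (rule mat_adjoint_mult[OF cU(1) cV(1)])
  have "mat_adjoint V * mat_adjoint U * (U * V) = mat_adjoint V * (mat_adjoint U * (U * V))"
    by (rule assoc_mult_mat[OF cV(2) cU(2) mult_carrier_mat[OF cU(1) cV(1)]])
  hence 1: "mat_adjoint V * mat_adjoint U * (U * V) = 1\<^sub>m n"
    using V unfolding unitary_cancel(2)[OF U cV(1)] by (simp add: unitary_mat_def)
  have "U * V * (mat_adjoint V * mat_adjoint U) = U * (V * (mat_adjoint V * mat_adjoint U))"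
    by (rule assoc_mult_mat[OF cU(1) cV(1) mult_carrier_mat[OF cV(2) cU(2)]])
  hence 2: "U * V * (mat_adjoint V * mat_adjoint U) = 1\<^sub>m n"
    using U unfolding unitary_cancel(1)[OF V cU(2)] by (simp add: unitary_mat_def)
  show ?thesis unfolding unitary_mat_def a using 1 2 mult_carrier_mat[OF cU(1) cV(1)] by simp
qed

section \<open>Matrices of the form G D G*\<close>

lemma unitary_diag_carrier:
  "U \<in> carrier_mat n n \<Longrightarrow> unitary_diag n U d \<in> carrier_mat n n"
  unfolding unitary_diag_def
  by (intro mult_carrier_mat[of _ n n _ n] mat_adjoint_carrier mat_diag_dim)

text \<open>The lemmas on \<open>unitary_diag n G d\<close> assume of \<open>G\<close> only that it is square wherever possible: for a general
  \<open>G\<close> with columns \<open>g\<^sub>k\<close> this matrix is the sum of the rank one matrices \<open>d\<^sub>k g\<^sub>k g\<^sub>k\<^sup>*\<close>, and such sums with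
  non-orthogonal \<open>g\<^sub>k\<close> are needed below.\<close>

lemma unitary_diag_index:
  assumes G: "G \<in> carrier_mat n n" and ij: "i < n" "j < n"
  shows "unitary_diag n G d $$ (i, j) = (\<Sum>k<n. G $$ (i, k) * d k * cnj (G $$ (j, k)))"
proof -
  have "unitary_diag n G d $$ (i, j)
      = (\<Sum>k<n. (G * mat_diag n (\<lambda>i. complex_of_real (d i))) $$ (i, k) * mat_adjoint G $$ (k, j))"
    unfolding unitary_diag_def
    by (rule mat_mult_index[OF mult_carrier_mat[OF G mat_diag_dim] mat_adjoint_carrier[OF G] ij])
  thus ?thesis using ij by (simp add: mat_diag_mult_right[OF G] mat_adjoint_index[OF G])
qed

lemma unitary_diag_diagonal_index:
  assumes G: "G \<in> carrier_mat n n" and i: "i < n"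
  shows "unitary_diag n G d $$ (i, i) = complex_of_real (\<Sum>k<n. d k * (cmod (G $$ (i, k)))\<^sup>2)"
  unfolding unitary_diag_index[OF G i i]
  by (simp add: complex_norm_square mult_ac del: of_real_power)

lemma unitary_diag_adjoint:
  assumes G: "G \<in> carrier_mat n n"
  shows "mat_adjoint (unitary_diag n G d) = unitary_diag n G d"
proof -
  note G' = mat_adjoint_carrier[OF G]
  let ?D = "mat_diag n (\<lambda>i. complex_of_real (d i))"
  have "mat_adjoint (unitary_diag n G d) = mat_adjoint (mat_adjoint G) * (mat_adjoint ?D * mat_adjoint G)"
    unfolding unitary_diag_def
    by (simp only: mat_adjoint_mult[OF mult_carrier_mat[OF G mat_diag_dim] G']
        mat_adjoint_mult[OF G mat_diag_dim])
  also have "\<dots> = unitary_diag n G d"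
    unfolding unitary_diag_def mat_adjoint_adjoint[OF G] mat_adjoint_diag
    by (rule assoc_mult_mat[OF G mat_diag_dim G', symmetric])
  finally show ?thesis .
qed

lemma unitary_diag_mult:
  assumes U: "unitary_mat n U"
  shows "unitary_diag n U d * unitary_diag n U e = unitary_diag n U (\<lambda>i. d i * e i)"
proof -
  note c = unitary_carrier[OF U] mat_diag_dim mult_carrier_mat[of _ n n _ n]
  note assoc = assoc_mult_mat[of _ n n _ n _ n]
  let ?D = "\<lambda>d. mat_diag n (\<lambda>i. complex_of_real (d i))"
  have "unitary_diag n U d * unitary_diag n U e
      = U * (?D d * (mat_adjoint U * (U * (?D e * mat_adjoint U))))"
    unfolding unitary_diag_def by (simp only: assoc c)
  also have "\<dots> = U * ((?D d * ?D e) * mat_adjoint U)"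
    by (simp only: unitary_cancel[OF U] assoc c)
  also have "\<dots> = unitary_diag n U (\<lambda>i. d i * e i)"
    unfolding unitary_diag_def mat_diag_diag of_real_mult by (simp only: assoc c)
  finally show ?thesis .
qed

lemma mat_diag_const_one: "mat_diag n (\<lambda>i. complex_of_real 1) = 1\<^sub>m n" by simp

lemma unitary_diag_one:
  assumes "G \<in> carrier_mat n n"
  shows "unitary_diag n G (\<lambda>_. 1) = G * mat_adjoint G"
  unfolding unitary_diag_def mat_diag_const_one using assms by simp

lemma unitary_diag_cong_diag:
  assumes "\<And>i. i < n \<Longrightarrow> d i = e i"
  shows "unitary_diag n G d = unitary_diag n G e"
proof -
  have "mat_diag n (\<lambda>i. complex_of_real (d i)) = mat_diag n (\<lambda>i. complex_of_real (e i))"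
    unfolding mat_diag_def by (rule eq_matI) (use assms in auto)
  thus ?thesis unfolding unitary_diag_def by simp
qed

lemma unitary_diag_scaled:
  assumes G: "G \<in> carrier_mat n n"
  shows "unitary_diag n (G * mat_diag n (\<lambda>i. complex_of_real (s i))) d = unitary_diag n G (\<lambda>i. s i * (d i * s i))"
proof -
  let ?D = "\<lambda>d. mat_diag n (\<lambda>i. complex_of_real (d i))"
  note c = G mat_adjoint_carrier[OF G] mat_diag_dim mult_carrier_mat[of _ n n _ n]
  have "unitary_diag n (G * ?D s) d = G * ((?D s * (?D d * ?D s)) * mat_adjoint G)"
    unfolding unitary_diag_def mat_adjoint_mult[OF G mat_diag_dim] mat_adjoint_diag
    by (simp only: assoc_mult_mat[of _ n n _ n _ n] c)
  also have "\<dots> = unitary_diag n G (\<lambda>i. s i * (d i * s i))"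
    unfolding unitary_diag_def mat_diag_diag of_real_mult by (simp only: assoc_mult_mat[of _ n n _ n _ n] c)
  finally show ?thesis .
qed

lemma unitary_diag_sandwich:
  assumes X: "X \<in> carrier_mat n n" and U: "U \<in> carrier_mat n n"
  shows "X * unitary_diag n U d * mat_adjoint X = unitary_diag n (X * U) d"
  unfolding unitary_diag_def mat_adjoint_mult[OF X U]
  by (simp only: assoc_mult_mat[of _ n n _ n _ n] mult_carrier_mat[of _ n n _ n] X U
      mat_adjoint_carrier[OF X] mat_adjoint_carrier[OF U] mat_diag_dim)

lemma unitary_diag_sandwich':
  assumes X: "X \<in> carrier_mat n n" and U: "U \<in> carrier_mat n n"
  shows "mat_adjoint X * unitary_diag n U d * X = unitary_diag n (mat_adjoint X * U) d"
  using unitary_diag_sandwich[OF mat_adjoint_carrier[OF X] U] unfolding mat_adjoint_adjoint[OF X] .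

lemma unitary_diag_recover:
  assumes U: "unitary_mat n U"
  shows "mat_adjoint U * unitary_diag n U d * U = mat_diag n (\<lambda>i. complex_of_real (d i))"
proof -
  note cU = unitary_carrier[OF U]
  let ?D = "mat_diag n (\<lambda>i. complex_of_real (d i))"
  have "mat_adjoint U * unitary_diag n U d * U = mat_adjoint U * (U * (?D * (mat_adjoint U * U)))"
    unfolding unitary_diag_def
    by (simp only: assoc_mult_mat[of _ n n _ n _ n] mult_carrier_mat[of _ n n _ n] cU mat_diag_dim)
  also have "\<dots> = ?D"
    using U by (simp add: unitary_mat_def unitary_cancel(2)[OF U mat_diag_dim] right_mult_one_mat[OF mat_diag_dim])
  finally show ?thesis .
qed

lemma mat_trace_diag_mult:
  assumes "X \<in> carrier_mat n n"
  shows "mat_trace (mat_diag n d * X) = (\<Sum>i<n. d i * X $$ (i, i))"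
  unfolding mat_trace_def mat_diag_mult_left[OF assms] by simp

lemma mat_trace_unitary_diag_mult:
  assumes G: "G \<in> carrier_mat n n" and X: "X \<in> carrier_mat n n"
  shows "mat_trace (unitary_diag n G d * X) = (\<Sum>i<n. d i * (mat_adjoint G * X * G) $$ (i, i))"
proof -
  note c = G X mat_adjoint_carrier[OF G] mat_diag_dim mult_carrier_mat[of _ n n _ n]
  note assoc = assoc_mult_mat[of _ n n _ n _ n]
  have "mat_trace (unitary_diag n G d * X) =
      mat_trace (G * (mat_diag n (\<lambda>i. complex_of_real (d i)) * (mat_adjoint G * X)))"
    unfolding unitary_diag_def by (simp only: assoc c)
  also have "\<dots> = mat_trace (mat_diag n (\<lambda>i. complex_of_real (d i)) * (mat_adjoint G * X) * G)"
    by (rule mat_trace_comm[of _ n n]) (simp_all only: c)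
  also have "\<dots> = mat_trace (mat_diag n (\<lambda>i. complex_of_real (d i)) * (mat_adjoint G * X * G))"
    by (simp only: assoc c)
  finally show ?thesis by (simp add: mat_trace_diag_mult c)
qed

lemma mat_trace_unitary_diag:
  assumes G: "G \<in> carrier_mat n n"
  shows "mat_trace (unitary_diag n G d) = complex_of_real (\<Sum>m<n. d m * (\<Sum>k<n. (cmod (G $$ (k, m)))\<^sup>2))"
proof -
  have "mat_trace (unitary_diag n G d) = mat_trace (unitary_diag n G d * 1\<^sub>m n)"
    using unitary_diag_carrier[OF G, of d] by simp
  also have "\<dots> = (\<Sum>i<n. d i * (mat_adjoint G * G) $$ (i, i))"
    using mat_trace_unitary_diag_mult[OF G, of "1\<^sub>m n" d] mat_adjoint_carrier[OF G] by simp
  finally show ?thesis by (simp add: adjoint_mult_self_index[OF G] del: index_mult_mat(1))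
qed

text \<open>The matrix \<open>U\<^sup>* V\<close> holds the inner products of the columns of \<open>U\<close> and \<open>V\<close>. For two eigenbases its squared
  moduli form a doubly stochastic matrix, which is how traces of products of two functions of noncommuting
  matrices become sums over pairs of eigenvalues.\<close>

lemma mat_trace_unitary_diag_pair:
  assumes U: "U \<in> carrier_mat n n" and V: "V \<in> carrier_mat n n"
  shows "mat_trace (unitary_diag n U a * unitary_diag n V b)
    = complex_of_real (\<Sum>i<n. \<Sum>j<n. (cmod ((mat_adjoint U * V) $$ (i, j)))\<^sup>2 * a i * b j)"
proof -
  have C: "mat_adjoint U * V \<in> carrier_mat n n" by (rule mult_carrier_mat[OF mat_adjoint_carrier[OF U] V])
  show ?thesis
    unfolding mat_trace_unitary_diag_mult[OF U unitary_diag_carrier[OF V]] unitary_diag_sandwich'[OF U V]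
    by (simp add: unitary_diag_diagonal_index[OF C] sum_distrib_left mult_ac del: index_mult_mat(1))
qed

lemma mat_trace_unitary_diag_right:
  assumes U: "unitary_mat n U" and V: "unitary_mat n V"
  shows "mat_trace (unitary_diag n U a)
    = complex_of_real (\<Sum>i<n. \<Sum>j<n. (cmod ((mat_adjoint U * V) $$ (i, j)))\<^sup>2 * a i)"
proof -
  have "unitary_diag n V (\<lambda>_. 1) = 1\<^sub>m n"
    unfolding unitary_diag_one[OF unitary_carrier(1)[OF V]] using V by (simp add: unitary_mat_def)
  thus ?thesis
    using mat_trace_unitary_diag_pair[OF unitary_carrier(1)[OF U] unitary_carrier(1)[OF V], of a "\<lambda>_. 1"]
      unitary_diag_carrier[OF unitary_carrier(1)[OF U], of a]
    by (simp del: index_mult_mat(1))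
qed

section \<open>The spectral theorem and functional calculus\<close>

text \<open>Complete \<open>v\<close> to a basis, apply the Gram-Schmidt procedure, which keeps the first vector, and normalize.\<close>

lemma unitary_first_column:
  fixes v :: "complex vec"
  assumes v: "v \<in> carrier_vec n" and v0: "v \<noteq> 0\<^sub>v n" and n: "0 < n"
  shows "\<exists>W c. unitary_mat n W \<and> col W 0 = c \<cdot>\<^sub>v v"
proof -
  interpret cof_vec_space n "TYPE(complex)" .
  define b where "b = basis_completion v"
  define ws where "ws = gram_schmidt n b"
  from basis_completion[OF v v0, folded b_def]
  have span_b: "span (set b) = carrier_vec n" and dist_b: "distinct b"
    and indep: "\<not> lin_dep (set b)" and b: "set b \<subseteq> carrier_vec n" and hdb: "hd b = v"
    and len_b: "length b = n" by auto
  from hdb len_b n obtain vs where bv: "b = v # vs" by (cases b, auto)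
  from gram_schmidt_result[OF b dist_b indep refl, folded ws_def]
  have ws: "set ws \<subseteq> carrier_vec n" "corthogonal ws" "length ws = n"
    by (auto simp: len_b)
  from gram_schmidt_hd[OF v, of vs, folded bv] have "hd ws = v" unfolding ws_def .
  with ws n have ws0: "ws ! 0 = v" by (metis hd_conv_nth length_0_conv not_gr0)
  have wsc: "ws ! i \<in> carrier_vec n" if "i < n" for i using ws that by auto
  \<comment> \<open>The squared norm is a complex number that happens to be positive, hence the complex square root.\<close>
  define r where "r i = 1 / csqrt (ws ! i \<bullet>c ws ! i)" for i
  define W where "W = mat n n (\<lambda>(i, j). r j * (ws ! j $ i))"
  have W: "W \<in> carrier_mat n n" unfolding W_def by simp
  have W_index: "W $$ (i, j) = r j * (ws ! j $ i)" if "i < n" "j < n" for i j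
    using that by (simp add: W_def)
  have "mat_adjoint W * W = 1\<^sub>m n"
  proof (rule eq_matI)
    fix i j assume "i < dim_row (1\<^sub>m n)" "j < dim_col (1\<^sub>m n)"
    hence ij: "i < n" "j < n" by auto
    have "(mat_adjoint W * W) $$ (i, j) = (\<Sum>k<n. cnj (r i * (ws ! i $ k)) * (r j * (ws ! j $ k)))"
      unfolding mat_mult_index[OF mat_adjoint_carrier[OF W] W ij]
      by (rule sum.cong) (use ij in \<open>simp_all add: mat_adjoint_index[OF W] W_index\<close>)
    also have "\<dots> = cnj (r i) * r j * (\<Sum>k<n. ws ! j $ k * cnj (ws ! i $ k))"
      by (simp add: sum_distrib_left mult_ac)
    also have "(\<Sum>k<n. ws ! j $ k * cnj (ws ! i $ k)) = ws ! j \<bullet>c ws ! i"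
      using wsc[OF ij(1)] wsc[OF ij(2)] by (auto simp: scalar_prod_def atLeast0LessThan)
    finally have *: "(mat_adjoint W * W) $$ (i, j) = cnj (r i) * r j * (ws ! j \<bullet>c ws ! i)" .
    show "(mat_adjoint W * W) $$ (i, j) = 1\<^sub>m n $$ (i, j)"
    proof (cases "i = j")
      case False
      with ij ws corthogonalD[OF ws(2), of j i] * show ?thesis by simp
    next
      case True
      define z where "z = ws ! i \<bullet>c ws ! i"
      have "z \<noteq> 0" using corthogonalD[OF ws(2), of i i] ij ws z_def by simp
      moreover have "0 \<le> z" unfolding z_def by (rule conjugate_square_ge_0_vec)
      ultimately have x: "z = complex_of_real (Re z)" "0 < Re z"
        by (auto simp: less_eq_complex_def complex_eq_iff)
      have "cnj (r i) * r i * z = complex_of_real (1 / sqrt (Re z) * (1 / sqrt (Re z)) * Re z)"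
      proof -
        have "r i = complex_of_real (1 / sqrt (Re z))"
          unfolding r_def z_def[symmetric] by (subst x(1)) (use x(2) in \<open>simp add: csqrt_of_real_nonneg\<close>)
        thus ?thesis by (simp only: complex_cnj_complex_of_real of_real_mult x(1)[symmetric])
      qed
      also have "1 / sqrt (Re z) * (1 / sqrt (Re z)) * Re z = 1" using x(2) by (simp add: field_simps)
      finally show ?thesis using * True ij z_def by simp
    qed
  qed (use W mat_adjoint_carrier[OF W] in auto)
  hence "unitary_mat n W" by (rule unitary_matI[OF W])
  moreover have "col W 0 = r 0 \<cdot>\<^sub>v v"
    using v n ws0 unfolding W_def by (intro eq_vecI) auto
  ultimately show ?thesis by blast
qed

text \<open>The spectral theorem, by induction on the dimension: conjugating with a unitary matrix whose first column
  is an eigenvector makes the first column of the matrix a multiple of the first unit vector. By symmetry the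
  same holds for the first row, so the matrix splits off a block of size one and the induction hypothesis
  applies to the rest.\<close>

lemma hermitian_diagonalizable:
  assumes "A \<in> carrier_mat n n" "mat_adjoint A = A"
  shows "\<exists>U d. unitary_mat n U \<and> A = unitary_diag n U d"
  using assms
proof (induction n arbitrary: A)
  case 0
  have "unitary_mat 0 (1\<^sub>m 0)" by (rule unitary_matI) (auto simp: mat_adjoint_def)
  moreover have "A = unitary_diag 0 (1\<^sub>m 0) d" for d
    using 0 unitary_diag_carrier[of "1\<^sub>m 0" 0 d] by (intro eq_matI) auto
  ultimately show ?case by blast
next
  case (Suc n)
  let ?N = "Suc n"
  note A = Suc.prems(1)
  from spectrum_non_empty[OF A] obtain e v where "eigenvector A v e"
    unfolding spectrum_def eigenvalue_def by auto
  hence v: "v \<in> carrier_vec ?N" "v \<noteq> 0\<^sub>v ?N" and Av: "A *\<^sub>v v = e \<cdot>\<^sub>v v"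
    using A unfolding eigenvector_def by auto
  from unitary_first_column[OF v] obtain W c where W: "unitary_mat ?N W" and W0: "col W 0 = c \<cdot>\<^sub>v v"
    by auto
  note cW = unitary_carrier[OF W]
  note c = A cW mult_carrier_mat[of _ ?N ?N _ ?N]
  note assoc = assoc_mult_mat[of _ ?N ?N _ ?N _ ?N]
  define M where "M = mat_adjoint W * (A * W)"
  have M: "M \<in> carrier_mat ?N ?N" unfolding M_def by (simp only: c)
  have "mat_adjoint M = mat_adjoint (A * W) * mat_adjoint (mat_adjoint W)"
    unfolding M_def by (rule mat_adjoint_mult[OF cW(2) mult_carrier_mat[OF A cW(1)]])
  also have "\<dots> = mat_adjoint W * A * W"
    unfolding mat_adjoint_adjoint[OF cW(1)] mat_adjoint_mult[OF A cW(1)] Suc.prems(2) ..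
  also have "\<dots> = M" unfolding M_def by (simp only: assoc c)
  finally have MM: "mat_adjoint M = M" .
  have herm: "M $$ (j, i) = cnj (M $$ (i, j))" if "i < ?N" "j < ?N" for i j
    using mat_adjoint_index[OF M that(2,1)] unfolding MM .
  have Mi0: "M $$ (i, 0) = (if i = 0 then e else 0)" if i: "i < ?N" for i
  proof -
    have AW0: "col (A * W) 0 = e \<cdot>\<^sub>v col W 0"
      unfolding col_mult2[OF A cW(1) zero_less_Suc] W0 mult_mat_vec[OF A v(1)] Av smult_smult_assoc
      by (simp only: mult.commute)
    have "M $$ (i, 0) = row (mat_adjoint W) i \<bullet> col (A * W) 0"
      unfolding M_def using A cW i by simp
    also have "\<dots> = e * (row (mat_adjoint W) i \<bullet> col W 0)"
      unfolding AW0 using scalar_prod_smult_distrib[of "row (mat_adjoint W) i" ?N "col W 0" e] cW i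
      by (metis carrier_matD(1,2) col_carrier_vec row_carrier_vec zero_less_Suc)
    also have "row (mat_adjoint W) i \<bullet> col W 0 = (mat_adjoint W * W) $$ (i, 0)"
      using cW i by simp
    finally show ?thesis using W i by (simp add: unitary_mat_def)
  qed
  define M' where "M' = mat n n (\<lambda>(i, j). M $$ (Suc i, Suc j))"
  have M': "M' \<in> carrier_mat n n" unfolding M'_def by simp
  have "mat_adjoint M' = M'"
  proof (rule eq_matI)
    fix i j assume "i < dim_row M'" "j < dim_col M'"
    hence ij: "i < n" "j < n" using M' by auto
    show "mat_adjoint M' $$ (i, j) = M' $$ (i, j)"
      using herm[of "Suc j" "Suc i"] ij by (simp add: mat_adjoint_index[OF M' ij]) (simp add: M'_def)
  qed (use mat_adjoint_carrier[OF M'] M' in auto)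
  from Suc.IH[OF M' this] obtain U d where U: "unitary_mat n U" and M'U: "M' = unitary_diag n U d"
    by blast
  note cU = unitary_carrier[OF U]
  define S where "S = mat ?N ?N (\<lambda>(i, j). case (i, j) of (0, 0) \<Rightarrow> 1 | (Suc k, Suc l) \<Rightarrow> U $$ (k, l)
    | _ \<Rightarrow> 0)"
  have S: "S \<in> carrier_mat ?N ?N" unfolding S_def by simp
  have S_index: "S $$ (0, 0) = 1" "k < n \<Longrightarrow> S $$ (0, Suc k) = 0" "k < n \<Longrightarrow> S $$ (Suc k, 0) = 0"
    "k < n \<Longrightarrow> l < n \<Longrightarrow> S $$ (Suc k, Suc l) = U $$ (k, l)" for k l
    unfolding S_def by simp_all
  have block: "unitary_diag ?N S g $$ (i, j) = (case (i, j) of (0, 0) \<Rightarrow> complex_of_real (g 0)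
      | (Suc k, Suc l) \<Rightarrow> unitary_diag n U (\<lambda>k. g (Suc k)) $$ (k, l) | _ \<Rightarrow> 0)"
    if "i < ?N" "j < ?N" for g i j
    unfolding unitary_diag_index[OF S that] sum.lessThan_Suc_shift
    using that by (auto split: nat.split simp: S_index unitary_diag_index[OF cU(1)])
  have "S * mat_adjoint S = 1\<^sub>m ?N"
    unfolding unitary_diag_one[OF S, symmetric]
  proof (rule eq_matI)
    fix i j assume "i < dim_row (1\<^sub>m ?N)" "j < dim_col (1\<^sub>m ?N)"
    hence ij: "i < ?N" "j < ?N" by auto
    have "U * mat_adjoint U = 1\<^sub>m n" using U by (simp add: unitary_mat_def)
    thus "unitary_diag ?N S (\<lambda>_. 1) $$ (i, j) = 1\<^sub>m ?N $$ (i, j)"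
      unfolding block[OF ij] using ij
      by (auto split: nat.split simp: unitary_diag_one[OF cU(1)] simp del: index_mult_mat(1))
  qed (use unitary_diag_carrier[OF S] in auto)
  hence SU: "unitary_mat ?N S" by (rule unitary_matI'[OF S])
  define g where "g i = (case i of 0 \<Rightarrow> Re e | Suc k \<Rightarrow> d k)" for i
  have e: "complex_of_real (Re e) = e"
    using herm[of 0 0] Mi0[of 0] by (simp add: complex_eq_iff)
  have Mdiag: "M = unitary_diag ?N S g"
  proof (rule eq_matI)
    fix i j assume "i < dim_row (unitary_diag ?N S g)" "j < dim_col (unitary_diag ?N S g)"
    hence ij: "i < ?N" "j < ?N" using unitary_diag_carrier[OF S, of g] by auto
    have M0j: "M $$ (0, Suc l) = 0" if "l < n" for l
      using herm[of "Suc l" 0] Mi0[of "Suc l"] that by simp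
    have MS: "M $$ (Suc k, Suc l) = unitary_diag n U d $$ (k, l)" if "k < n" "l < n" for k l
      using that unfolding M'U[symmetric] by (simp add: M'_def)
    show "M $$ (i, j) = unitary_diag ?N S g $$ (i, j)"
      unfolding block[OF ij] using ij
      by (auto split: nat.split simp: g_def e Mi0 M0j MS)
  qed (use M unitary_diag_carrier[OF S, of g] in auto)
  have "A = W * (mat_adjoint W * (A * (W * mat_adjoint W)))"
    using W unitary_cancel(1)[OF W A] A by (simp add: unitary_mat_def)
  also have "\<dots> = W * (M * mat_adjoint W)" unfolding M_def by (simp only: assoc c)
  also have "\<dots> = unitary_diag ?N (W * S) g"
    unfolding Mdiag unitary_diag_def mat_adjoint_mult[OF cW(1) S]
    by (simp only: assoc c S mat_adjoint_carrier[OF S] mat_diag_dim)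
  finally show ?case using unitary_mult[OF W SU] by blast
qed

lemma sandwich_diagonal_index:
  fixes M X :: "complex mat"
  assumes M: "M \<in> carrier_mat n n" and X: "X \<in> carrier_mat n n" and i: "i < n"
  shows "(mat_adjoint X * M * X) $$ (i, i) = (M *\<^sub>v col X i) \<bullet>c col X i"
proof -
  have "(mat_adjoint X * M * X) $$ (i, i) = (mat_adjoint X * (M * X)) $$ (i, i)"
    by (simp only: assoc_mult_mat[OF mat_adjoint_carrier[OF X] M X])
  also have "\<dots> = (\<Sum>k<n. mat_adjoint X $$ (i, k) * (M * X) $$ (k, i))"
    by (rule mat_mult_index[OF mat_adjoint_carrier[OF X] mult_carrier_mat[OF M X] i i])
  also have "\<dots> = (\<Sum>k<n. (M *\<^sub>v col X i) $ k * cnj (X $$ (k, i)))"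
    by (rule sum.cong) (use M X i in \<open>simp_all add: mat_adjoint_index[OF X] mult.commute\<close>)
  also have "\<dots> = (M *\<^sub>v col X i) \<bullet>c col X i"
    using X M i by (auto simp: scalar_prod_def atLeast0LessThan intro!: sum.cong)
  finally show ?thesis .
qed

lemma sandwich_square_index:
  assumes G: "G \<in> carrier_mat n n" and Y: "Y \<in> carrier_mat n n" and i: "i < n"
  shows "(mat_adjoint G * (mat_adjoint Y * Y) * G) $$ (i, i)
    = complex_of_real (\<Sum>k<n. (cmod ((Y * G) $$ (k, i)))\<^sup>2)"
proof -
  note c = G Y mat_adjoint_carrier[OF G] mat_adjoint_carrier[OF Y] mult_carrier_mat[of _ n n _ n]
  note assoc = assoc_mult_mat[of _ n n _ n _ n]
  have "mat_adjoint G * (mat_adjoint Y * Y) * G = mat_adjoint (Y * G) * (Y * G)"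
    unfolding mat_adjoint_mult[OF Y G] by (simp only: assoc c)
  thus ?thesis using adjoint_mult_self_index[OF mult_carrier_mat[OF Y G] i] by simp
qed

lemma psd_eigenvalue_nonneg:
  assumes U: "unitary_mat n U" and psd: "psd_mat n (unitary_diag n U a)" and i: "i < n"
  shows "0 \<le> a i"
proof -
  note cU = unitary_carrier[OF U]
  have "complex_of_real (a i) = (unitary_diag n U a *\<^sub>v col U i) \<bullet>c col U i"
    using sandwich_diagonal_index[OF unitary_diag_carrier[OF cU(1)] cU(1) i, of a] i
    unfolding unitary_diag_recover[OF U] by (simp add: mat_diag_def)
  also have "0 \<le> \<dots>" using psd cU i by (auto simp: psd_mat_def)
  finally show ?thesis by (simp add: less_eq_complex_def)
qed

lemma pd_eigenvalue_pos:
  assumes U: "unitary_mat n U" and pd: "pd_mat n (unitary_diag n U a)" and i: "i < n"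
  shows "0 < a i"
proof -
  note cU = unitary_carrier[OF U]
  have v: "col U i \<in> carrier_vec n" using cU i by auto
  have "(mat_adjoint U * 1\<^sub>m n * U) $$ (i, i) = 1"
    using U cU i by (simp add: unitary_mat_def)
  hence "(1\<^sub>m n *\<^sub>v col U i) \<bullet>c col U i = 1"
    using sandwich_diagonal_index[OF one_carrier_mat cU(1) i] by simp
  hence "col U i \<noteq> 0\<^sub>v n" by auto
  have "complex_of_real (a i) = (unitary_diag n U a *\<^sub>v col U i) \<bullet>c col U i"
    using sandwich_diagonal_index[OF unitary_diag_carrier[OF cU(1)] cU(1) i, of a] i
    unfolding unitary_diag_recover[OF U] by (simp add: mat_diag_def)
  also have "0 < \<dots>" using pd v \<open>col U i \<noteq> 0\<^sub>v n\<close> by (auto simp: pd_mat_def)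
  finally show ?thesis by (simp add: less_complex_def)
qed

lemma gram_eigenvalue_nonneg:
  assumes U: "unitary_mat n U" and X: "X \<in> carrier_mat n n"
    and eq: "mat_adjoint X * X = unitary_diag n U d" and i: "i < n"
  shows "0 \<le> d i"
proof -
  note cU = unitary_carrier[OF U]
  have "complex_of_real (d i) = complex_of_real (\<Sum>k<n. (cmod ((X * U) $$ (k, i)))\<^sup>2)"
    using sandwich_square_index[OF cU(1) X i] i unfolding eq unitary_diag_recover[OF U]
    by (simp add: mat_diag_def)
  thus ?thesis unfolding of_real_eq_iff by (simp add: sum_nonneg)
qed

text \<open>All positive semidefinite matrices that occur besides \<open>A\<close> and \<open>B\<close> come with a factorization \<open>X\<^sup>* X\<close>, which
  gives nonnegative eigenvalues at once.\<close>

lemma gram_diagonalizable: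
  assumes X: "X \<in> carrier_mat n n"
  obtains U d where "unitary_mat n U" "mat_adjoint X * X = unitary_diag n U d" "\<And>i. i < n \<Longrightarrow> 0 \<le> d i"
proof -
  note X' = mat_adjoint_carrier[OF X]
  have "mat_adjoint (mat_adjoint X * X) = mat_adjoint X * X"
    unfolding mat_adjoint_mult[OF X' X] mat_adjoint_adjoint[OF X] ..
  from hermitian_diagonalizable[OF mult_carrier_mat[OF X' X] this] obtain U d
    where "unitary_mat n U" "mat_adjoint X * X = unitary_diag n U d" by blast
  with gram_eigenvalue_nonneg[OF _ X] that show ?thesis by blast
qed

text \<open>In the two eigenbases the hypothesis reads \<open>d\<^sub>i W\<^sub>i\<^sub>j = W\<^sub>i\<^sub>j e\<^sub>j\<close>, so \<open>W\<close> vanishes outside the pairs of equal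
  eigenvalues. This yields \<open>f(Z Z\<^sup>*) Z = Z f(Z\<^sup>* Z)\<close>, also for a singular \<open>Z\<close>.\<close>

lemma functional_calculus_intertwine:
  assumes U: "unitary_mat n U" and V: "unitary_mat n V" and Z: "Z \<in> carrier_mat n n"
    and eq: "unitary_diag n U d * Z = Z * unitary_diag n V e"
  shows "unitary_diag n U (\<lambda>i. f (d i)) * Z = Z * unitary_diag n V (\<lambda>i. f (e i))"
proof -
  note c = unitary_carrier[OF U] unitary_carrier[OF V] Z mat_diag_dim mult_carrier_mat[of _ n n _ n]
  note assoc = assoc_mult_mat[of _ n n _ n _ n]
  let ?D = "\<lambda>d. mat_diag n (\<lambda>i. complex_of_real (d i))"
  define W where "W = mat_adjoint U * Z * V"
  have W: "W \<in> carrier_mat n n" unfolding W_def by (simp only: c)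
  have Zeq: "Z = U * (W * mat_adjoint V)"
    using unitary_cancel[OF U] V c unfolding W_def unitary_mat_def by (simp add: assoc)
  have l: "unitary_diag n U g * Z = U * ((?D g * W) * mat_adjoint V)" for g
  proof -
    have "unitary_diag n U g * Z = U * (?D g * (mat_adjoint U * (U * (W * mat_adjoint V))))"
      unfolding unitary_diag_def Zeq by (simp only: assoc c W)
    thus ?thesis by (simp only: unitary_cancel[OF U] assoc c W)
  qed
  have r: "Z * unitary_diag n V g = U * ((W * ?D g) * mat_adjoint V)" for g
  proof -
    have "Z * unitary_diag n V g = U * (W * (mat_adjoint V * (V * (?D g * mat_adjoint V))))"
      unfolding unitary_diag_def Zeq by (simp only: assoc c W)
    thus ?thesis by (simp only: unitary_cancel[OF V] assoc c W)
  qed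
  have cancel: "X = mat_adjoint U * (U * (X * mat_adjoint V)) * V" if "X \<in> carrier_mat n n" for X
    using that V by (simp add: unitary_cancel[OF U] c assoc) (simp add: unitary_mat_def)
  have "?D d * W = W * ?D e"
    using eq unfolding l r by (metis cancel W mat_diag_dim mult_carrier_mat)
  hence "(?D d * W) $$ (i, j) = (W * ?D e) $$ (i, j)" for i j by (rule arg_cong)
  hence "d i * W $$ (i, j) = W $$ (i, j) * e j" if "i < n" "j < n" for i j
    using that unfolding mat_diag_mult_left[OF W] mat_diag_mult_right[OF W]
    by (metis (mono_tags, lifting) case_prod_conv index_mat(1))
  hence *: "f (d i) * W $$ (i, j) = W $$ (i, j) * f (e j)" if "i < n" "j < n" for i j
    using that by (metis mult.commute mult_cancel_left of_real_eq_iff mult_eq_0_iff)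
  have "?D (\<lambda>i. f (d i)) * W = W * ?D (\<lambda>i. f (e i))"
    unfolding mat_diag_mult_left[OF W] mat_diag_mult_right[OF W]
    by (rule eq_matI) (use * in auto)
  thus ?thesis unfolding l r by simp
qed

text \<open>The case distinction in the definition of the matrix logarithm disappears since \<open>ln 0 = 0\<close> for the total
  function \<open>ln\<close>.\<close>

lemma mat_log_unitary_diag:
  assumes "unitary_mat n U"
  shows "mat_log (unitary_diag n U d) = unitary_diag n U (\<lambda>i. ln (d i))"
proof -
  have "(\<lambda>x::real. if x = 0 then 0 else ln x) = ln" by auto
  thus ?thesis unfolding mat_log_def using mat_fun_unitary_diag[OF assms, of ln d] by simp
qed

lemma mat_powr_unitary_diag:
  assumes "unitary_mat n U"
  shows "mat_powr (unitary_diag n U d) p = unitary_diag n U (\<lambda>i. d i powr p)"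
  unfolding mat_powr_def by (rule mat_fun_unitary_diag[OF assms])

lemma mat_inv_eqI:
  assumes A: "A \<in> carrier_mat n n" and X: "X \<in> carrier_mat n n"
    and AX: "A * X = 1\<^sub>m n" and XA: "X * A = 1\<^sub>m n"
  shows "mat_inv A = X"
proof (cases "mat_inverse A")
  case None
  from mat_inverse(1)[OF A None] A X AX XA show ?thesis
    by (auto simp: Units_def ring_mat_simps)
next
  case (Some Y)
  from mat_inverse(2)[OF A Some] have Y: "A * Y = 1\<^sub>m n" "Y \<in> carrier_mat n n" by auto
  have "Y = (X * A) * Y" unfolding XA using Y by simp
  also have "\<dots> = X * (A * Y)" by (rule assoc_mult_mat[OF X A Y(2)])
  also have "\<dots> = X" unfolding Y(1) using X by simp
  finally show ?thesis using Some by (simp add: mat_inv_def)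
qed

section \<open>A variational quasi-entropy\<close>

text \<open>For positive semidefinite \<open>A\<close> and \<open>B\<close> this is the concave quadratic functional
  \<open>2 Re \<langle>A, Y\<rangle> - \<langle>Y, (L\<^sub>A + t R\<^sub>B) Y\<rangle>\<close>. It is linear in the pair \<open>(A, B)\<close> for fixed \<open>Y\<close>, which is what makes it
  useful for decompositions of \<open>A\<close> and \<open>B\<close>.\<close>

definition variational_form :: "nat \<Rightarrow> real \<Rightarrow> complex mat \<Rightarrow> complex mat \<Rightarrow> complex mat \<Rightarrow> real" where
  "variational_form n t A B Y = 2 * Re (mat_trace (A * Y)) - Re (mat_trace (A * (Y * mat_adjoint Y)))
     - t * Re (mat_trace (B * (mat_adjoint Y * Y)))"

text \<open>For \<open>A\<close> and \<open>B\<close> with eigenvalues \<open>a\<close> and \<open>b\<close> and overlap matrix \<open>C\<close> of their eigenbases, this is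
  \<open>\<langle>A, (L\<^sub>A + t R\<^sub>B)\<^sup>-\<^sup>1 A\<rangle>\<close>, the quasi-entropy of Petz for the function \<open>x\<^sup>2 / (x + t)\<close>. The convention \<open>0 / 0 = 0\<close>
  gives the right value where both eigenvalues vanish.\<close>

definition quasi_entropy :: "nat \<Rightarrow> real \<Rightarrow> (nat \<Rightarrow> real) \<Rightarrow> (nat \<Rightarrow> real) \<Rightarrow> complex mat \<Rightarrow> real" where
  "quasi_entropy n t a b C = (\<Sum>i<n. \<Sum>j<n. (cmod (C $$ (i, j)))\<^sup>2 * ((a i)\<^sup>2 / (a i + t * b j)))"

text \<open>This is used with eigenbases for \<open>G\<close> and \<open>H\<close>, and with a common non-orthogonal \<open>G = H\<close>.\<close>

lemma variational_form_diag:
  assumes G: "G \<in> carrier_mat n n" and H: "H \<in> carrier_mat n n" and Y: "Y \<in> carrier_mat n n"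
  shows "variational_form n t (unitary_diag n G a) (unitary_diag n H b) Y =
    (\<Sum>i<n. 2 * a i * Re ((mat_adjoint G * Y * G) $$ (i, i))
       - a i * (\<Sum>k<n. (cmod ((mat_adjoint Y * G) $$ (k, i)))\<^sup>2))
    - t * (\<Sum>j<n. b j * (\<Sum>k<n. (cmod ((Y * H) $$ (k, j)))\<^sup>2))"
proof -
  note Y' = mat_adjoint_carrier[OF Y]
  have 1: "Re (mat_trace (unitary_diag n G a * Y)) = (\<Sum>i<n. a i * Re ((mat_adjoint G * Y * G) $$ (i, i)))"
    by (simp add: mat_trace_unitary_diag_mult[OF G Y] del: index_mult_mat(1))
  have 2: "Re (mat_trace (unitary_diag n G a * (Y * mat_adjoint Y)))
      = (\<Sum>i<n. a i * (\<Sum>k<n. (cmod ((mat_adjoint Y * G) $$ (k, i)))\<^sup>2))"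
    using sandwich_square_index[OF G Y'] unfolding mat_adjoint_adjoint[OF Y]
    by (simp add: mat_trace_unitary_diag_mult[OF G mult_carrier_mat[OF Y Y']] del: index_mult_mat(1))
  have 3: "Re (mat_trace (unitary_diag n H b * (mat_adjoint Y * Y)))
      = (\<Sum>j<n. b j * (\<Sum>k<n. (cmod ((Y * H) $$ (k, j)))\<^sup>2))"
    using sandwich_square_index[OF H Y]
    by (simp add: mat_trace_unitary_diag_mult[OF H mult_carrier_mat[OF Y' Y]] del: index_mult_mat(1))
  show ?thesis unfolding variational_form_def 1 2 3
    by (simp add: sum_subtractf sum_distrib_left mult_ac)
qed

lemma unitary_column_norm:
  assumes U: "unitary_mat n U" and M: "M \<in> carrier_mat n n" and i: "i < n"
  shows "(\<Sum>k<n. (cmod ((U * M) $$ (k, i)))\<^sup>2) = (\<Sum>k<n. (cmod (M $$ (k, i)))\<^sup>2)"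
proof -
  note c = unitary_carrier[OF U] M mat_adjoint_carrier[OF M] mult_carrier_mat[of _ n n _ n]
  note assoc = assoc_mult_mat[of _ n n _ n _ n]
  have "mat_adjoint (U * M) * (U * M) = mat_adjoint M * (mat_adjoint U * (U * M))"
    unfolding mat_adjoint_mult[OF c(1) M] by (simp only: assoc c)
  hence "mat_adjoint (U * M) * (U * M) = mat_adjoint M * M" by (simp only: unitary_cancel[OF U M])
  thus ?thesis
    using adjoint_mult_self_index[OF M i] adjoint_mult_self_index[OF mult_carrier_mat[OF c(1) M] i]
    by (simp only: of_real_eq_iff)
qed

text \<open>In the pair of eigenbases the functional decouples into one scalar quadratic for each entry of \<open>W\<close>, which
  can be maximized separately.\<close>

lemma variational_form_eigenbases:
  assumes U: "unitary_mat n U" and V: "unitary_mat n V" and W: "W \<in> carrier_mat n n"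
  shows "variational_form n t (unitary_diag n U a) (unitary_diag n V b) (U * W * mat_adjoint V) =
    (\<Sum>i<n. \<Sum>j<n. 2 * a i * Re (W $$ (i, j) * cnj ((mat_adjoint U * V) $$ (i, j)))
       - (a i + t * b j) * (cmod (W $$ (i, j)))\<^sup>2)"
proof -
  note cU = unitary_carrier[OF U] and cV = unitary_carrier[OF V] and W' = mat_adjoint_carrier[OF W]
  note c = cU cV W W' mult_carrier_mat[of _ n n _ n]
  note assoc = assoc_mult_mat[of _ n n _ n _ n]
  define Y where "Y = U * W * mat_adjoint V"
  define C where "C = mat_adjoint U * V"
  have C: "C \<in> carrier_mat n n" unfolding C_def by (simp only: c)
  have Y: "Y \<in> carrier_mat n n" unfolding Y_def by (simp only: c)
  have "mat_adjoint C = mat_adjoint V * U"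
    unfolding C_def mat_adjoint_mult[OF cU(2) cV(1)] mat_adjoint_adjoint[OF cU(1)] ..
  moreover have "mat_adjoint U * Y * U = mat_adjoint U * (U * (W * (mat_adjoint V * U)))"
    unfolding Y_def by (simp only: assoc c)
  ultimately have 1: "mat_adjoint U * Y * U = W * mat_adjoint C"
    by (simp only: unitary_cancel[OF U] c)
  have 11: "(mat_adjoint U * Y * U) $$ (i, i) = (\<Sum>j<n. W $$ (i, j) * cnj (C $$ (i, j)))" if "i < n" for i
    unfolding 1 mat_mult_index[OF W mat_adjoint_carrier[OF C] that that]
    by (rule sum.cong) (use that in \<open>simp_all add: mat_adjoint_index[OF C]\<close>)
  have "mat_adjoint Y = V * (mat_adjoint W * mat_adjoint U)"
    unfolding Y_def mat_adjoint_mult[OF mult_carrier_mat[OF cU(1) W] cV(2)]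
      mat_adjoint_mult[OF cU(1) W] mat_adjoint_adjoint[OF cV(1)] ..
  hence "mat_adjoint Y * U = V * (mat_adjoint W * (mat_adjoint U * U))" by (simp only: assoc c)
  hence 2: "mat_adjoint Y * U = V * mat_adjoint W"
    using U W' by (simp add: unitary_mat_def)
  have 22: "(\<Sum>k<n. (cmod ((mat_adjoint Y * U) $$ (k, i)))\<^sup>2) = (\<Sum>j<n. (cmod (W $$ (i, j)))\<^sup>2)"
    if "i < n" for i
    unfolding 2 unitary_column_norm[OF V W' that]
    by (rule sum.cong) (use that in \<open>simp_all add: mat_adjoint_index[OF W]\<close>)
  have "Y * V = U * (W * (mat_adjoint V * V))" unfolding Y_def by (simp only: assoc c)
  hence 3: "Y * V = U * W" using V W by (simp add: unitary_mat_def)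
  have 33: "(\<Sum>k<n. (cmod ((Y * V) $$ (k, j)))\<^sup>2) = (\<Sum>i<n. (cmod (W $$ (i, j)))\<^sup>2)" if "j < n" for j
    unfolding 3 by (rule unitary_column_norm[OF U W that])
  have "t * (\<Sum>j<n. b j * (\<Sum>k<n. (cmod ((Y * V) $$ (k, j)))\<^sup>2))
      = (\<Sum>j<n. \<Sum>i<n. t * b j * (cmod (W $$ (i, j)))\<^sup>2)"
    by (simp add: 33 sum_distrib_left mult_ac del: index_mult_mat(1))
  also have "\<dots> = (\<Sum>i<n. \<Sum>j<n. t * b j * (cmod (W $$ (i, j)))\<^sup>2)" by (rule sum.swap)
  finally show ?thesis
    unfolding Y_def[symmetric] C_def[symmetric] variational_form_diag[OF cU(1) cV(1) Y]
    by (simp add: 11 22 sum_subtractf sum_distrib_left sum.distrib algebra_simps del: index_mult_mat(1))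
qed

text \<open>Completing the square, with maximum at \<open>w = a c / (a + t b)\<close>.\<close>

lemma scalar_completion:
  assumes "0 \<le> a" "0 \<le> b" "0 < t"
  shows "2 * a * Re (w * cnj c) - (a + t * b) * (cmod w)\<^sup>2 \<le> (cmod c)\<^sup>2 * (a\<^sup>2 / (a + t * b))"
proof (cases "a + t * b = 0")
  case True
  hence "a = 0" using assms by (smt (verit) mult_nonneg_nonneg)
  thus ?thesis unfolding True by simp
next
  case False
  define s where "s = a + t * b"
  have s: "s > 0" using False assms unfolding s_def by (smt (verit) mult_nonneg_nonneg)
  have "Re (w * cnj c) \<le> cmod w * cmod c" by (metis complex_Re_le_cmod complex_mod_cnj norm_mult)
  hence "2 * a * Re (w * cnj c) \<le> 2 * a * (cmod w * cmod c)"
    using assms by (intro mult_left_mono) auto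
  also have "2 * a * (cmod w * cmod c) - s * (cmod w)\<^sup>2
      = (cmod c)\<^sup>2 * (a\<^sup>2 / s) - s * (cmod w - a * cmod c / s)\<^sup>2"
    using s by (simp add: field_simps power2_eq_square)
  hence "2 * a * (cmod w * cmod c) - s * (cmod w)\<^sup>2 \<le> (cmod c)\<^sup>2 * (a\<^sup>2 / s)"
    using s by simp
  ultimately show ?thesis unfolding s_def by linarith
qed

lemma variational_form_le:
  assumes U: "unitary_mat n U" and V: "unitary_mat n V" and Y: "Y \<in> carrier_mat n n"
    and a: "\<And>i. i < n \<Longrightarrow> 0 \<le> a i" and b: "\<And>i. i < n \<Longrightarrow> 0 \<le> b i" and t: "0 < t"
  shows "variational_form n t (unitary_diag n U a) (unitary_diag n V b) Y
    \<le> quasi_entropy n t a b (mat_adjoint U * V)"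
proof -
  note c = unitary_carrier[OF U] unitary_carrier[OF V] Y mult_carrier_mat[of _ n n _ n]
  note assoc = assoc_mult_mat[of _ n n _ n _ n]
  define W where "W = mat_adjoint U * Y * V"
  have W: "W \<in> carrier_mat n n" unfolding W_def by (simp only: c)
  have "U * W * mat_adjoint V = U * (mat_adjoint U * (Y * (V * mat_adjoint V)))"
    unfolding W_def by (simp only: assoc c)
  hence "U * W * mat_adjoint V = Y"
    using V Y by (simp add: unitary_mat_def unitary_cancel[OF U Y])
  hence "variational_form n t (unitary_diag n U a) (unitary_diag n V b) Y =
    (\<Sum>i<n. \<Sum>j<n. 2 * a i * Re (W $$ (i, j) * cnj ((mat_adjoint U * V) $$ (i, j)))
       - (a i + t * b j) * (cmod (W $$ (i, j)))\<^sup>2)"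
    using variational_form_eigenbases[OF U V W] by metis
  also have "\<dots> \<le> quasi_entropy n t a b (mat_adjoint U * V)"
    unfolding quasi_entropy_def by (intro sum_mono scalar_completion a b t) auto
  finally show ?thesis .
qed

lemma variational_form_attained:
  assumes U: "unitary_mat n U" and V: "unitary_mat n V"
    and a: "\<And>i. i < n \<Longrightarrow> 0 \<le> a i" and b: "\<And>i. i < n \<Longrightarrow> 0 \<le> b i" and t: "0 < t"
  shows "\<exists>Y\<in>carrier_mat n n. variational_form n t (unitary_diag n U a) (unitary_diag n V b) Y
    = quasi_entropy n t a b (mat_adjoint U * V)"
proof -
  define C where "C = mat_adjoint U * V"
  define W where "W = mat n n (\<lambda>(i, j). complex_of_real (a i / (a i + t * b j)) * C $$ (i, j))"
  have W: "W \<in> carrier_mat n n" unfolding W_def by simp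
  have "2 * a i * Re (W $$ (i, j) * cnj (C $$ (i, j))) - (a i + t * b j) * (cmod (W $$ (i, j)))\<^sup>2
      = (cmod (C $$ (i, j)))\<^sup>2 * ((a i)\<^sup>2 / (a i + t * b j))" if ij: "i < n" "j < n" for i j
  proof -
    define s where "s = a i + t * b j"
    have Wij: "W $$ (i, j) = complex_of_real (a i / s) * C $$ (i, j)" using ij by (simp add: W_def s_def)
    have "W $$ (i, j) * cnj (C $$ (i, j)) = complex_of_real (a i / s * (cmod (C $$ (i, j)))\<^sup>2)"
      unfolding Wij by (simp add: complex_norm_square[symmetric] mult.assoc del: of_real_power
          flip: of_real_power of_real_mult)
    hence 1: "Re (W $$ (i, j) * cnj (C $$ (i, j))) = a i / s * (cmod (C $$ (i, j)))\<^sup>2" by simp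
    have 2: "(cmod (W $$ (i, j)))\<^sup>2 = (a i / s)\<^sup>2 * (cmod (C $$ (i, j)))\<^sup>2"
      unfolding Wij norm_mult norm_of_real power_mult_distrib power2_abs ..
    show ?thesis unfolding 1 2 s_def[symmetric]
      by (cases "s = 0") (simp_all add: field_simps power2_eq_square)
  qed
  hence "variational_form n t (unitary_diag n U a) (unitary_diag n V b) (U * W * mat_adjoint V)
      = quasi_entropy n t a b C"
    unfolding variational_form_eigenbases[OF U V W] C_def[symmetric] quasi_entropy_def
    by (intro sum.cong refl) auto
  moreover have "U * W * mat_adjoint V \<in> carrier_mat n n"
    using unitary_carrier[OF U] unitary_carrier[OF V] W by (intro mult_carrier_mat)
  ultimately show ?thesis unfolding C_def by blast
qed

lemma column_Cauchy_Schwarz: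
  assumes P: "P \<in> carrier_mat n n" and R: "R \<in> carrier_mat n n" and m: "m < n"
  shows "(cmod ((mat_adjoint P * R) $$ (m, m)))\<^sup>2
    \<le> (\<Sum>k<n. (cmod (P $$ (k, m)))\<^sup>2) * (\<Sum>k<n. (cmod (R $$ (k, m)))\<^sup>2)"
proof -
  let ?p = "\<lambda>k. cmod (P $$ (k, m))" and ?r = "\<lambda>k. cmod (R $$ (k, m))"
  have "cmod ((mat_adjoint P * R) $$ (m, m)) \<le> (\<Sum>k<n. \<bar>?p k\<bar> * \<bar>?r k\<bar>)"
    unfolding mat_mult_index[OF mat_adjoint_carrier[OF P] R m m]
    by (rule order_trans[OF norm_sum])
      (auto intro!: sum_mono simp: norm_mult mat_adjoint_index[OF P] m)
  also have "\<dots> \<le> L2_set ?p {..<n} * L2_set ?r {..<n}" by (rule L2_set_mult_ineq)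
  finally have "(cmod ((mat_adjoint P * R) $$ (m, m)))\<^sup>2 \<le> (L2_set ?p {..<n} * L2_set ?r {..<n})\<^sup>2"
    by (rule power_mono) simp
  thus ?thesis by (simp add: power_mult_distrib L2_set_def sum_nonneg)
qed

text \<open>With the lower bounds \<open>s\<^sup>2 / r\<close> for \<open>p\<close> and \<open>q\<close> the left-hand side is a quadratic in \<open>s\<close> with maximum at
  \<open>s = r d / (d + t)\<close>.\<close>

lemma reverse_test_scalar:
  fixes s d t r p q :: real
  assumes d: "0 \<le> d" and t: "0 < t" and r: "0 \<le> r" and p: "s\<^sup>2 \<le> r * p" and q: "s\<^sup>2 \<le> r * q"
    and pq: "0 \<le> p" "0 \<le> q"
  shows "2 * d * s - d * p - t * q \<le> r * (d\<^sup>2 / (d + t))"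
proof (cases "r = 0")
  case True
  hence "s = 0" using p by simp
  moreover have "0 \<le> d * p" "0 \<le> t * q" using d t pq by (simp_all add: mult_nonneg_nonneg)
  ultimately show ?thesis unfolding True by simp
next
  case False
  hence r: "r > 0" using r by simp
  have "d * (s\<^sup>2 / r) \<le> d * p" "t * (s\<^sup>2 / r) \<le> t * q"
    using p q d t r by (auto intro!: mult_left_mono simp: field_simps)
  moreover have "r * (d\<^sup>2 / (d + t)) - (2 * d * s - d * (s\<^sup>2 / r) - t * (s\<^sup>2 / r))
      = (d + t) / r * (s - r * d / (d + t))\<^sup>2"
  proof -
    define u where "u = d + t"
    have "u > 0" using d t u_def by simp
    have "r * (d\<^sup>2 / u) - (2 * d * s - u * (s\<^sup>2 / r)) = u / r * (s - r * d / u)\<^sup>2"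
      using r \<open>u > 0\<close> by (simp add: field_simps power2_eq_square)
    thus ?thesis unfolding u_def by (simp add: algebra_simps add_divide_distrib)
  qed
  moreover have "0 \<le> (d + t) / r * (s - r * d / (d + t))\<^sup>2" using d t r by simp
  ultimately show ?thesis by linarith
qed

text \<open>Evaluate the functional at its maximizer and split it along the columns \<open>g\<^sub>m\<close> of \<open>G\<close>. The term of \<open>g = g\<^sub>m\<close>
  involves \<open>Y\<close> through \<open>\<langle>g, Y g\<rangle>\<close>, \<open>|Y\<^sup>* g|\<^sup>2\<close> and \<open>|Y g|\<^sup>2\<close>, and by Cauchy-Schwarz both squared norms are at least
  \<open>|\<langle>g, Y g\<rangle>|\<^sup>2 / |g|\<^sup>2\<close>, so the scalar estimate applies. A simultaneous decomposition of two positive matrices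
  into proportional rank one pieces is Matsumoto's reverse test.\<close>

lemma quasi_entropy_reverse_test:
  assumes U: "unitary_mat n U" and V: "unitary_mat n V" and G: "G \<in> carrier_mat n n"
    and a: "\<And>i. i < n \<Longrightarrow> 0 \<le> a i" and b: "\<And>i. i < n \<Longrightarrow> 0 \<le> b i" and t: "0 < t"
    and d: "\<And>i. i < n \<Longrightarrow> 0 \<le> d i"
    and A: "unitary_diag n U a = unitary_diag n G d" and B: "unitary_diag n V b = G * mat_adjoint G"
  shows "quasi_entropy n t a b (mat_adjoint U * V)
    \<le> (\<Sum>m<n. (\<Sum>k<n. (cmod (G $$ (k, m)))\<^sup>2) * ((d m)\<^sup>2 / (d m + t)))"
proof -
  from variational_form_attained[of n U V a b t, OF U V a b t] obtain Y where Y: "Y \<in> carrier_mat n n"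
    and eq: "variational_form n t (unitary_diag n U a) (unitary_diag n V b) Y
      = quasi_entropy n t a b (mat_adjoint U * V)" by blast
  note Y' = mat_adjoint_carrier[OF Y] and G' = mat_adjoint_carrier[OF G]
  let ?r = "\<lambda>m. \<Sum>k<n. (cmod (G $$ (k, m)))\<^sup>2"
  let ?p = "\<lambda>m. \<Sum>k<n. (cmod ((mat_adjoint Y * G) $$ (k, m)))\<^sup>2"
  let ?q = "\<lambda>m. \<Sum>k<n. (cmod ((Y * G) $$ (k, m)))\<^sup>2"
  let ?s = "\<lambda>m. (mat_adjoint G * Y * G) $$ (m, m)"
  have "quasi_entropy n t a b (mat_adjoint U * V)
      = (\<Sum>m<n. 2 * d m * Re (?s m) - d m * ?p m - t * ?q m)"
    unfolding eq[symmetric] A B unitary_diag_one[OF G, symmetric] variational_form_diag[OF G G Y]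
    by (simp add: sum_subtractf sum_distrib_left del: index_mult_mat(1))
  also have "\<dots> \<le> (\<Sum>m<n. ?r m * ((d m)\<^sup>2 / (d m + t)))"
  proof (rule sum_mono)
    fix m assume "m \<in> {..<n}"
    hence m: "m < n" by simp
    have le: "(Re (?s m))\<^sup>2 \<le> (cmod (?s m))\<^sup>2"
      using abs_Re_le_cmod[of "?s m"] by (metis abs_ge_zero power2_abs power_mono)
    have 1: "mat_adjoint G * Y * G = mat_adjoint G * (Y * G)"
      by (rule assoc_mult_mat[OF G' Y G])
    have "mat_adjoint (mat_adjoint Y * G) * G = mat_adjoint G * Y * G"
      unfolding mat_adjoint_mult[OF Y' G] mat_adjoint_adjoint[OF Y] ..
    hence 2: "(cmod (?s m))\<^sup>2 \<le> ?r m * ?p m"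
      using column_Cauchy_Schwarz[OF mult_carrier_mat[OF Y' G] G m] by (simp only: mult.commute)
    have 3: "(cmod (?s m))\<^sup>2 \<le> ?r m * ?q m"
      unfolding 1 by (rule column_Cauchy_Schwarz[OF G mult_carrier_mat[OF Y G] m])
    show "2 * d m * Re (?s m) - d m * ?p m - t * ?q m \<le> ?r m * ((d m)\<^sup>2 / (d m + t))"
      by (rule reverse_test_scalar)
        (use d[OF m] t order_trans[OF le 2] order_trans[OF le 3] in \<open>auto intro!: sum_nonneg simp del: index_mult_mat(1)\<close>)
  qed
  finally show ?thesis .
qed

text \<open>Choose \<open>Y\<close> diagonal in the basis of the columns of \<open>V\<close>, with the entries that would be optimal if \<open>A\<close> and \<open>B\<close>
  were diagonal there as well.\<close>

lemma quasi_entropy_measured: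
  assumes U: "unitary_mat n U" and U': "unitary_mat n U'" and V: "unitary_mat n V"
    and a: "\<And>i. i < n \<Longrightarrow> 0 \<le> a i" and b: "\<And>i. i < n \<Longrightarrow> 0 \<le> b i" and t: "0 < t"
  defines "k \<equiv> \<lambda>j. Re ((mat_adjoint V * unitary_diag n U a * V) $$ (j, j))"
    and "q \<equiv> \<lambda>j. Re ((mat_adjoint V * unitary_diag n U' b * V) $$ (j, j))"
  shows "(\<Sum>j<n. (k j)\<^sup>2 / (k j + t * q j)) \<le> quasi_entropy n t a b (mat_adjoint U * U')"
proof -
  define y where "y j = k j / (k j + t * q j)" for j
  define Y where "Y = unitary_diag n V y"
  let ?K = "unitary_diag n U a" and ?Q = "unitary_diag n U' b"
  note cV = unitary_carrier[OF V]
  have K: "?K \<in> carrier_mat n n" and Q: "?Q \<in> carrier_mat n n"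
    using unitary_diag_carrier unitary_carrier[OF U] unitary_carrier[OF U'] by auto
  have ud: "unitary_diag n V g \<in> carrier_mat n n" for g by (rule unitary_diag_carrier[OF cV(1)])
  have Y: "Y \<in> carrier_mat n n" unfolding Y_def by (rule ud)
  have tr: "Re (mat_trace (M * unitary_diag n V g)) = (\<Sum>j<n. g j * Re ((mat_adjoint V * M * V) $$ (j, j)))"
    if M: "M \<in> carrier_mat n n" for g M
    unfolding mat_trace_comm[OF M ud] mat_trace_unitary_diag_mult[OF cV(1) M]
    by (simp del: index_mult_mat(1))
  have "variational_form n t ?K ?Q Y = 2 * (\<Sum>j<n. y j * k j) - (\<Sum>j<n. y j * y j * k j)
      - t * (\<Sum>j<n. y j * y j * q j)"
    unfolding variational_form_def Y_def unitary_diag_adjoint[OF cV(1)] unitary_diag_mult[OF V]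
      tr[OF K] tr[OF Q] k_def q_def ..
  also have "\<dots> = (\<Sum>j<n. 2 * (y j * k j) - y j * y j * (k j + t * q j))"
    by (simp add: sum_subtractf sum_distrib_left sum.distrib algebra_simps)
  also have "\<dots> = (\<Sum>j<n. (k j)\<^sup>2 / (k j + t * q j))"
  proof (rule sum.cong[OF refl])
    fix j
    show "2 * (y j * k j) - y j * y j * (k j + t * q j) = (k j)\<^sup>2 / (k j + t * q j)"
    proof (cases "k j + t * q j = 0")
      case False
      define s where "s = k j + t * q j"
      have "s \<noteq> 0" using False s_def by simp
      hence "2 * (k j / s * k j) - k j / s * (k j / s) * s = (k j)\<^sup>2 / s"
        by (simp add: field_simps power2_eq_square)
      thus ?thesis unfolding y_def s_def .
    qed (simp add: y_def)
  qed
  finally show ?thesis using variational_form_le[of n U U' Y a b t, OF U U' Y a b t] by simp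
qed

section \<open>From resolvents to logarithms\<close>

text \<open>The difference \<open>G(t) = \<Sum> w' log (x' + t) - \<Sum> w log (x + t)\<close> is nondecreasing, since the hypothesis compares
  the derivatives of the two sums, and it tends to \<open>0\<close> at infinity because the total weights agree. Hence \<open>G(0) \<le> 0\<close>.\<close>

lemma weighted_ln_le_of_resolvent_le:
  fixes w x :: "'a \<Rightarrow> real" and w' x' :: "'b \<Rightarrow> real"
  assumes x: "\<And>i. i \<in> I \<Longrightarrow> 0 \<le> x i" "\<And>i. i \<in> I \<Longrightarrow> x i = 0 \<Longrightarrow> w i = 0"
    and x': "\<And>j. j \<in> J \<Longrightarrow> 0 \<le> x' j" "\<And>j. j \<in> J \<Longrightarrow> x' j = 0 \<Longrightarrow> w' j = 0"
    and total: "sum w I = sum w' J"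
    and le: "\<And>t. 0 < t \<Longrightarrow> (\<Sum>i\<in>I. w i / (x i + t)) \<le> (\<Sum>j\<in>J. w' j / (x' j + t))"
  shows "(\<Sum>j\<in>J. w' j * ln (x' j)) \<le> (\<Sum>i\<in>I. w i * ln (x i))"
proof -
  define G where "G t = (\<Sum>j\<in>J. w' j * ln (x' j + t)) - (\<Sum>i\<in>I. w i * ln (x i + t))" for t
  have G_deriv: "(G has_real_derivative
      (\<Sum>j\<in>J. w' j / (x' j + t)) - (\<Sum>i\<in>I. w i / (x i + t))) (at t)" if "0 < t" for t
  proof -
    have "((\<lambda>t. \<Sum>j\<in>J. w' j * ln (x' j + t)) has_real_derivative (\<Sum>j\<in>J. w' j / (x' j + t))) (at t)"
    proof (rule DERIV_sum)
      fix j assume "j \<in> J"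
      hence "0 < x' j + t" using x'(1)[of j] that by simp
      thus "((\<lambda>t. w' j * ln (x' j + t)) has_real_derivative w' j / (x' j + t)) (at t)"
        by (auto intro!: derivative_eq_intros)
    qed
    moreover have "((\<lambda>t. \<Sum>i\<in>I. w i * ln (x i + t)) has_real_derivative (\<Sum>i\<in>I. w i / (x i + t))) (at t)"
    proof (rule DERIV_sum)
      fix i assume "i \<in> I"
      hence "0 < x i + t" using x(1)[of i] that by simp
      thus "((\<lambda>t. w i * ln (x i + t)) has_real_derivative w i / (x i + t)) (at t)"
        by (auto intro!: derivative_eq_intros)
    qed
    ultimately show ?thesis unfolding G_def[abs_def] by (rule DERIV_diff)
  qed
  have G_mono: "G s \<le> G t" if st: "0 < s" "s \<le> t" for s t
  proof (rule DERIV_nonneg_imp_nondecreasing[OF st(2)])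
    fix u assume "s \<le> u" "u \<le> t"
    hence u: "0 < u" using st by simp
    show "\<exists>y. (G has_real_derivative y) (at u) \<and> 0 \<le> y" using G_deriv[OF u] le[OF u] by auto
  qed
  have ln_diff: "((\<lambda>t. ln (c + t) - ln t) \<longlongrightarrow> 0) at_top" if "0 \<le> c" for c :: real
  proof -
    have "((\<lambda>t. c / t) \<longlongrightarrow> 0) at_top"
      by (rule tendsto_divide_0[OF tendsto_const]) (simp add: filterlim_ident filterlim_at_top_imp_at_infinity)
    hence "((\<lambda>t. ln (1 + c / t)) \<longlongrightarrow> ln (1 + 0)) at_top" by (intro tendsto_intros) auto
    moreover have "\<forall>\<^sub>F t in at_top. ln (1 + c / t) = ln (c + t) - ln t"
      using eventually_gt_at_top[of 0]
    proof eventually_elim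
      case (elim t)
      have "1 + c / t = (c + t) / t" using elim by (simp add: field_simps)
      thus ?case using elim that by (simp add: ln_div)
    qed
    ultimately show ?thesis by (simp cong: filterlim_cong)
  qed
  have G_eq: "G t = (\<Sum>j\<in>J. w' j * (ln (x' j + t) - ln t)) - (\<Sum>i\<in>I. w i * (ln (x i + t) - ln t))" for t
    unfolding G_def using total
    by (simp add: right_diff_distrib sum_subtractf sum_distrib_right[symmetric])
  have "(G \<longlongrightarrow> (\<Sum>j\<in>J. w' j * 0) - (\<Sum>i\<in>I. w i * 0)) at_top"
    unfolding G_eq[abs_def] by (intro tendsto_intros ln_diff x x')
  hence G_lim: "(G \<longlongrightarrow> 0) at_top" by simp
  have G_nonpos: "G s \<le> 0" if "0 < s" for s
    by (rule tendsto_lowerbound[OF G_lim])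
      (use that in \<open>auto intro!: eventually_mono[OF eventually_ge_at_top[of s]] G_mono\<close>)
  have ln_at_0: "((\<lambda>t. v * ln (y + t)) \<longlongrightarrow> v * ln y) (at_right 0)"
    if "0 \<le> y" "y = 0 \<Longrightarrow> v = 0" for v y :: real
  proof (cases "y = 0")
    case False
    have "((\<lambda>t. v * ln (y + t)) \<longlongrightarrow> v * ln (y + 0)) (at_right 0)"
      by (intro tendsto_intros) (use False in auto)
    thus ?thesis by simp
  qed (use that in simp)
  have "(G \<longlongrightarrow> (\<Sum>j\<in>J. w' j * ln (x' j)) - (\<Sum>i\<in>I. w i * ln (x i))) (at_right 0)"
    unfolding G_def[abs_def] by (intro tendsto_diff tendsto_sum ln_at_0 x x')
  moreover have "\<forall>\<^sub>F s in at_right 0. G s \<le> 0"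
    using eventually_at_right_less[of "0::real"] by eventually_elim (rule G_nonpos)
  ultimately have "(\<Sum>j\<in>J. w' j * ln (x' j)) - (\<Sum>i\<in>I. w i * ln (x i)) \<le> 0"
    by (rule tendsto_upperbound) simp
  thus ?thesis by simp
qed

text \<open>The same expression \<open>p\<^sup>2 / (p + t q)\<close> enters the resolvent of \<open>p / q\<close> with weight \<open>p\<close> negatively and that with
  weight \<open>p\<^sup>2 / q\<close> positively. This is why the two monotonicity lemmas below have opposite directions.\<close>

lemma quotient_resolvent:
  fixes p q t :: real
  assumes "0 \<le> p" "0 \<le> q" "q = 0 \<Longrightarrow> p = 0" "0 < t"
  shows "p / (p / q + t) = (p - p\<^sup>2 / (p + t * q)) / t"
    and "(p\<^sup>2 / q) / (p / q + t) = p\<^sup>2 / (p + t * q)"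
proof -
  have "p / (p / q + t) = (p - p\<^sup>2 / (p + t * q)) / t \<and> (p\<^sup>2 / q) / (p / q + t) = p\<^sup>2 / (p + t * q)"
  proof (cases "q = 0")
    case False
    define s where "s = p + t * q"
    have q: "0 < q" using False assms by simp
    have s: "0 < s" using q assms unfolding s_def by (simp add: add_nonneg_pos)
    have 1: "p / q + t = s / q" using q by (simp add: s_def field_simps)
    have p: "p = s - t * q" by (simp add: s_def)
    show ?thesis unfolding s_def[symmetric] 1
      using q s assms(4) by (simp add: field_simps power2_eq_square) (simp add: p algebra_simps)
  qed (use assms in auto)
  thus "p / (p / q + t) = (p - p\<^sup>2 / (p + t * q)) / t"
    and "(p\<^sup>2 / q) / (p / q + t) = p\<^sup>2 / (p + t * q)" by auto
qed

lemma quotient_ln: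
  fixes p q c :: real
  assumes "0 \<le> p" "0 \<le> q" "q = 0 \<Longrightarrow> p = 0" "p = 0 \<Longrightarrow> c = 0"
  shows "c * ln (p / q) = c * (ln p - ln q)"
  using assms by (cases "p = 0") (auto simp: ln_div)

text \<open>The index sets carry families of pairs \<open>(p, q)\<close>, thought of as weights of two measures; the summand is
  \<open>q f(p / q)\<close> for \<open>f(x) = x log x\<close>.\<close>

lemma classical_relative_entropy_mono:
  fixes p q :: "'a \<Rightarrow> real" and p' q' :: "'b \<Rightarrow> real"
  assumes I: "\<And>i. i \<in> I \<Longrightarrow> 0 \<le> p i" "\<And>i. i \<in> I \<Longrightarrow> 0 \<le> q i" "\<And>i. i \<in> I \<Longrightarrow> q i = 0 \<Longrightarrow> p i = 0"
    and J: "\<And>j. j \<in> J \<Longrightarrow> 0 \<le> p' j" "\<And>j. j \<in> J \<Longrightarrow> 0 \<le> q' j" "\<And>j. j \<in> J \<Longrightarrow> q' j = 0 \<Longrightarrow> p' j = 0"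
    and total: "sum p I = sum p' J"
    and le: "\<And>t. 0 < t \<Longrightarrow> (\<Sum>i\<in>I. (p i)\<^sup>2 / (p i + t * q i)) \<le> (\<Sum>j\<in>J. (p' j)\<^sup>2 / (p' j + t * q' j))"
  shows "(\<Sum>i\<in>I. p i * (ln (p i) - ln (q i))) \<le> (\<Sum>j\<in>J. p' j * (ln (p' j) - ln (q' j)))"
proof -
  have "(\<Sum>i\<in>I. p i * ln (p i / q i)) \<le> (\<Sum>j\<in>J. p' j * ln (p' j / q' j))"
  proof (rule weighted_ln_le_of_resolvent_le)
    fix t :: real assume t: "0 < t"
    have "(\<Sum>j\<in>J. p' j / (p' j / q' j + t)) = (\<Sum>j\<in>J. (p' j - (p' j)\<^sup>2 / (p' j + t * q' j)) / t)"
      by (intro sum.cong refl quotient_resolvent(1) J t)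
    also have "\<dots> \<le> (\<Sum>i\<in>I. (p i - (p i)\<^sup>2 / (p i + t * q i)) / t)"
      using le[OF t] t total
      by (simp add: sum_subtractf sum_divide_distrib[symmetric] divide_right_mono)
    also have "\<dots> = (\<Sum>i\<in>I. p i / (p i / q i + t))"
      by (intro sum.cong refl quotient_resolvent(1)[symmetric] I t)
    finally show "(\<Sum>j\<in>J. p' j / (p' j / q' j + t)) \<le> (\<Sum>i\<in>I. p i / (p i / q i + t))" .
  qed (use I J total in \<open>auto simp: divide_nonneg_nonneg\<close>)
  also have "(\<Sum>i\<in>I. p i * ln (p i / q i)) = (\<Sum>i\<in>I. p i * (ln (p i) - ln (q i)))"
    by (rule sum.cong[OF refl], rule quotient_ln) (use I in auto)
  also have "(\<Sum>j\<in>J. p' j * ln (p' j / q' j)) = (\<Sum>j\<in>J. p' j * (ln (p' j) - ln (q' j)))"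
    by (rule sum.cong[OF refl], rule quotient_ln) (use J in auto)
  finally show ?thesis .
qed

text \<open>The counterpart for \<open>f(x) = x\<^sup>2 log x\<close>, where the order is reversed.\<close>

lemma classical_square_log_antimono:
  fixes p q :: "'a \<Rightarrow> real" and p' q' :: "'b \<Rightarrow> real"
  assumes I: "\<And>i. i \<in> I \<Longrightarrow> 0 \<le> p i" "\<And>i. i \<in> I \<Longrightarrow> 0 \<le> q i" "\<And>i. i \<in> I \<Longrightarrow> q i = 0 \<Longrightarrow> p i = 0"
    and J: "\<And>j. j \<in> J \<Longrightarrow> 0 \<le> p' j" "\<And>j. j \<in> J \<Longrightarrow> 0 \<le> q' j" "\<And>j. j \<in> J \<Longrightarrow> q' j = 0 \<Longrightarrow> p' j = 0"
    and total: "(\<Sum>i\<in>I. (p i)\<^sup>2 / q i) = (\<Sum>j\<in>J. (p' j)\<^sup>2 / q' j)"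
    and le: "\<And>t. 0 < t \<Longrightarrow> (\<Sum>i\<in>I. (p i)\<^sup>2 / (p i + t * q i)) \<le> (\<Sum>j\<in>J. (p' j)\<^sup>2 / (p' j + t * q' j))"
  shows "(\<Sum>j\<in>J. (p' j)\<^sup>2 / q' j * (ln (p' j) - ln (q' j))) \<le> (\<Sum>i\<in>I. (p i)\<^sup>2 / q i * (ln (p i) - ln (q i)))"
proof -
  have "(\<Sum>j\<in>J. (p' j)\<^sup>2 / q' j * ln (p' j / q' j)) \<le> (\<Sum>i\<in>I. (p i)\<^sup>2 / q i * ln (p i / q i))"
  proof (rule weighted_ln_le_of_resolvent_le)
    fix t :: real assume t: "0 < t"
    have "(\<Sum>i\<in>I. (p i)\<^sup>2 / q i / (p i / q i + t)) = (\<Sum>i\<in>I. (p i)\<^sup>2 / (p i + t * q i))"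
      by (intro sum.cong refl quotient_resolvent(2) I t)
    also have "\<dots> \<le> (\<Sum>j\<in>J. (p' j)\<^sup>2 / (p' j + t * q' j))" by (rule le[OF t])
    also have "\<dots> = (\<Sum>j\<in>J. (p' j)\<^sup>2 / q' j / (p' j / q' j + t))"
      by (intro sum.cong refl quotient_resolvent(2)[symmetric] J t)
    finally show "(\<Sum>i\<in>I. (p i)\<^sup>2 / q i / (p i / q i + t)) \<le> (\<Sum>j\<in>J. (p' j)\<^sup>2 / q' j / (p' j / q' j + t))" .
  qed (use I J total in \<open>auto simp: divide_nonneg_nonneg\<close>)
  also have "(\<Sum>i\<in>I. (p i)\<^sup>2 / q i * ln (p i / q i)) = (\<Sum>i\<in>I. (p i)\<^sup>2 / q i * (ln (p i) - ln (q i)))"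
    by (intro sum.cong refl quotient_ln I) auto
  also have "(\<Sum>j\<in>J. (p' j)\<^sup>2 / q' j * ln (p' j / q' j)) = (\<Sum>j\<in>J. (p' j)\<^sup>2 / q' j * (ln (p' j) - ln (q' j)))"
    by (intro sum.cong refl quotient_ln J) auto
  finally show ?thesis .
qed

section \<open>Relative entropy inequalities for matrices\<close>

text \<open>\<open>Tr A (log A - log B)\<close> in terms of the eigenvalues of \<open>A\<close> and \<open>B\<close> and the overlap matrix \<open>C\<close> of their
  eigenbases.\<close>

definition relative_entropy :: "nat \<Rightarrow> (nat \<Rightarrow> real) \<Rightarrow> (nat \<Rightarrow> real) \<Rightarrow> complex mat \<Rightarrow> real" where
  "relative_entropy n a b C = (\<Sum>i<n. \<Sum>j<n. (cmod (C $$ (i, j)))\<^sup>2 * a i * (ln (a i) - ln (b j)))"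

lemma quotient_scale:
  fixes c x y t :: real
  shows "c * (x\<^sup>2 / (x + t * y)) = (c * x)\<^sup>2 / (c * x + t * (c * y))"
proof (cases "c = 0")
  case False
  have "c * x + t * (c * y) = c * (x + t * y)" by (simp add: algebra_simps)
  thus ?thesis using False by (simp add: power2_eq_square)
qed simp

text \<open>The two families \<open>|C\<^sub>i\<^sub>j|\<^sup>2 a\<^sub>i\<close> and \<open>|C\<^sub>i\<^sub>j|\<^sup>2 b\<^sub>j\<close> (the Nussbaum-Szkola distributions) turn quantities of a pair
  of matrices into quantities of a pair of measures on a product set.\<close>

lemma quasi_entropy_eq_classical:
  "quasi_entropy n t a b C = (\<Sum>(i, j)\<in>{..<n} \<times> {..<n}.
     ((cmod (C $$ (i, j)))\<^sup>2 * a i)\<^sup>2 / ((cmod (C $$ (i, j)))\<^sup>2 * a i + t * ((cmod (C $$ (i, j)))\<^sup>2 * b j)))"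
  unfolding quasi_entropy_def sum.cartesian_product quotient_scale by simp

lemma scaled_ln_diff:
  fixes c x y :: real
  assumes "0 \<le> c" "0 \<le> x" "0 \<le> y" "c = 0 \<or> x = 0 \<or> y \<noteq> 0"
  shows "c * x * (ln (c * x) - ln (c * y)) = c * x * (ln x - ln y)"
    and "(c * x)\<^sup>2 / (c * y) * (ln (c * x) - ln (c * y)) = c * (x\<^sup>2 / y * (ln x - ln y))"
proof -
  consider "c = 0 \<or> x = 0" | "0 < c" "0 < x" "0 < y" using assms by fastforce
  hence "c * x * (ln (c * x) - ln (c * y)) = c * x * (ln x - ln y) \<and>
      (c * x)\<^sup>2 / (c * y) * (ln (c * x) - ln (c * y)) = c * (x\<^sup>2 / y * (ln x - ln y))"
  proof cases
    case 2
    hence "ln (c * x) - ln (c * y) = ln x - ln y" by (simp add: ln_mult)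
    thus ?thesis using 2 by (simp add: power2_eq_square)
  qed auto
  thus "c * x * (ln (c * x) - ln (c * y)) = c * x * (ln x - ln y)"
    and "(c * x)\<^sup>2 / (c * y) * (ln (c * x) - ln (c * y)) = c * (x\<^sup>2 / y * (ln x - ln y))" by auto
qed

lemma relative_entropy_eq_classical:
  assumes a: "\<And>i. i < n \<Longrightarrow> 0 \<le> a i" and b: "\<And>i. i < n \<Longrightarrow> 0 \<le> b i"
    and supp: "\<And>i j. i < n \<Longrightarrow> j < n \<Longrightarrow> b j = 0 \<Longrightarrow> C $$ (i, j) = 0 \<or> a i = 0"
  shows "relative_entropy n a b C = (\<Sum>(i, j)\<in>{..<n} \<times> {..<n}. (cmod (C $$ (i, j)))\<^sup>2 * a i *
     (ln ((cmod (C $$ (i, j)))\<^sup>2 * a i) - ln ((cmod (C $$ (i, j)))\<^sup>2 * b j)))"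
  unfolding relative_entropy_def sum.cartesian_product
proof (rule sum.cong[OF refl])
  fix ij assume "ij \<in> {..<n} \<times> {..<n}"
  then obtain i j where ij: "ij = (i, j)" "i < n" "j < n" by auto
  have "(cmod (C $$ (i, j)))\<^sup>2 * a i * (ln (a i) - ln (b j)) = (cmod (C $$ (i, j)))\<^sup>2 * a i *
     (ln ((cmod (C $$ (i, j)))\<^sup>2 * a i) - ln ((cmod (C $$ (i, j)))\<^sup>2 * b j))"
    using a b supp[of i j] ij by (intro scaled_ln_diff(1)[symmetric]) auto
  thus "(case ij of (i, j) \<Rightarrow> (cmod (C $$ (i, j)))\<^sup>2 * a i * (ln (a i) - ln (b j))) =
     (case ij of (i, j) \<Rightarrow> (cmod (C $$ (i, j)))\<^sup>2 * a i *
     (ln ((cmod (C $$ (i, j)))\<^sup>2 * a i) - ln ((cmod (C $$ (i, j)))\<^sup>2 * b j)))"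
    using ij by simp
qed

text \<open>The relative entropy is at most the one computed from a simultaneous rank one decomposition, whose pieces
  are the pairs \<open>(|g\<^sub>m|\<^sup>2 d\<^sub>m, |g\<^sub>m|\<^sup>2)\<close>. The hypothesis on zero eigenvalues says that the support of \<open>A\<close> is contained
  in that of \<open>B\<close>.\<close>

lemma relative_entropy_le_reverse_test:
  assumes U: "unitary_mat n U" and V: "unitary_mat n V" and G: "G \<in> carrier_mat n n"
    and a: "\<And>i. i < n \<Longrightarrow> 0 \<le> a i" and b: "\<And>i. i < n \<Longrightarrow> 0 \<le> b i" and d: "\<And>i. i < n \<Longrightarrow> 0 \<le> d i"
    and A: "unitary_diag n U a = unitary_diag n G d" and B: "unitary_diag n V b = G * mat_adjoint G"
    and supp: "\<And>i j. i < n \<Longrightarrow> j < n \<Longrightarrow> b j = 0 \<Longrightarrow> (mat_adjoint U * V) $$ (i, j) = 0 \<or> a i = 0"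
  shows "relative_entropy n a b (mat_adjoint U * V) \<le> (\<Sum>m<n. (\<Sum>k<n. (cmod (G $$ (k, m)))\<^sup>2) * d m * ln (d m))"
proof -
  define C where "C = mat_adjoint U * V"
  define r where "r m = (\<Sum>k<n. (cmod (G $$ (k, m)))\<^sup>2)" for m
  have r: "0 \<le> r m" for m unfolding r_def by (intro sum_nonneg) simp
  let ?c = "\<lambda>i j. (cmod (C $$ (i, j)))\<^sup>2"
  have supp': "C $$ (i, j) = 0" if "i < n" "j < n" "b j = 0" "a i \<noteq> 0" for i j
    using supp[OF that(1-3)] that(4) by (simp add: C_def)
  have scale: "r m * ((d m)\<^sup>2 / (d m + t)) = (r m * d m)\<^sup>2 / (r m * d m + t * r m)" for m t
    using quotient_scale[of "r m" "d m" t 1] by (simp only: mult_1_right)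
  have "relative_entropy n a b C = (\<Sum>ij\<in>{..<n} \<times> {..<n}. (case ij of (i, j) \<Rightarrow> ?c i j * a i) *
     (ln (case ij of (i, j) \<Rightarrow> ?c i j * a i) - ln (case ij of (i, j) \<Rightarrow> ?c i j * b j)))"
    using relative_entropy_eq_classical[of n a b C] a b supp[folded C_def] by (simp add: case_prod_beta)
  also have "\<dots> \<le> (\<Sum>m<n. r m * d m * (ln (r m * d m) - ln (r m)))"
  proof (rule classical_relative_entropy_mono)
    have "complex_of_real (\<Sum>ij\<in>{..<n} \<times> {..<n}. case ij of (i, j) \<Rightarrow> ?c i j * a i)
        = complex_of_real (\<Sum>m<n. d m * r m)"
      using mat_trace_unitary_diag_right[OF U V, of a] mat_trace_unitary_diag[OF G, of d]
      unfolding A C_def r_def sum.cartesian_product by simp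
    thus "(\<Sum>ij\<in>{..<n} \<times> {..<n}. case ij of (i, j) \<Rightarrow> ?c i j * a i) = (\<Sum>m<n. r m * d m)"
      unfolding of_real_eq_iff by (simp add: mult.commute)
  next
    fix t :: real assume "0 < t"
    from quasi_entropy_reverse_test[of n U V G a b t d, OF U V G a b this d A B]
    show "(\<Sum>ij\<in>{..<n} \<times> {..<n}. (case ij of (i, j) \<Rightarrow> ?c i j * a i)\<^sup>2 /
        ((case ij of (i, j) \<Rightarrow> ?c i j * a i) + t * (case ij of (i, j) \<Rightarrow> ?c i j * b j)))
      \<le> (\<Sum>m<n. (r m * d m)\<^sup>2 / (r m * d m + t * r m))"
      unfolding quasi_entropy_eq_classical C_def[symmetric] r_def[symmetric] scale
      by (simp add: case_prod_beta)
  qed (use a b d r supp' in \<open>auto split: prod.splits\<close>)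
  also have "\<dots> = (\<Sum>m<n. r m * d m * ln (d m))"
  proof (rule sum.cong[OF refl])
    fix m assume "m \<in> {..<n}"
    thus "r m * d m * (ln (r m * d m) - ln (r m)) = r m * d m * ln (d m)"
      using scaled_ln_diff(1)[of "r m" "d m" 1] r[of m] d[of m] by simp
  qed
  finally show ?thesis unfolding C_def r_def .
qed

text \<open>The same comparison of quasi-entropies, read for \<open>x\<^sup>2 log x\<close>, where it bounds the value on the decomposition
  from above. The equality of total weights is the case of the function \<open>x\<^sup>2\<close>, for which both sides are
  \<open>Tr A B\<^sup>-\<^sup>1 A\<close>.\<close>

lemma square_log_ge_reverse_test:
  assumes U: "unitary_mat n U" and V: "unitary_mat n V" and G: "G \<in> carrier_mat n n"
    and a: "\<And>i. i < n \<Longrightarrow> 0 \<le> a i" and b: "\<And>i. i < n \<Longrightarrow> 0 < b i" and d: "\<And>i. i < n \<Longrightarrow> 0 \<le> d i"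
    and A: "unitary_diag n U a = unitary_diag n G d" and B: "unitary_diag n V b = G * mat_adjoint G"
    and total: "(\<Sum>i<n. \<Sum>j<n. (cmod ((mat_adjoint U * V) $$ (i, j)))\<^sup>2 * (a i)\<^sup>2 * (1 / b j))
      = (\<Sum>m<n. (\<Sum>k<n. (cmod (G $$ (k, m)))\<^sup>2) * (d m)\<^sup>2)"
  shows "(\<Sum>m<n. (\<Sum>k<n. (cmod (G $$ (k, m)))\<^sup>2) * ((d m)\<^sup>2 * ln (d m)))
    \<le> (\<Sum>i<n. \<Sum>j<n. (cmod ((mat_adjoint U * V) $$ (i, j)))\<^sup>2 * ((a i)\<^sup>2 / b j * (ln (a i) - ln (b j))))"
proof -
  define C where "C = mat_adjoint U * V"
  define r where "r m = (\<Sum>k<n. (cmod (G $$ (k, m)))\<^sup>2)" for m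
  have r: "0 \<le> r m" for m unfolding r_def by (intro sum_nonneg) simp
  have b': "0 \<le> b i" if "i < n" for i using b[OF that] by simp
  let ?c = "\<lambda>i j. (cmod (C $$ (i, j)))\<^sup>2"
  let ?p = "\<lambda>ij. case ij of (i, j) \<Rightarrow> ?c i j * a i" and ?q = "\<lambda>ij. case ij of (i, j) \<Rightarrow> ?c i j * b j"
  have scale: "r m * ((d m)\<^sup>2 / (d m + t)) = (r m * d m)\<^sup>2 / (r m * d m + t * r m)" for m t
    using quotient_scale[of "r m" "d m" t 1] by (simp only: mult_1_right)
  have cancel: "(x * y)\<^sup>2 / (x * z) = x * (y\<^sup>2 / z)" "(x * y)\<^sup>2 / x = x * y\<^sup>2" for x y z :: real
    by (cases "x = 0"; simp add: power2_eq_square)+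
  have "(\<Sum>m<n. r m * ((d m)\<^sup>2 * ln (d m))) = (\<Sum>m<n. (r m * d m)\<^sup>2 / r m * (ln (r m * d m) - ln (r m)))"
  proof (rule sum.cong[OF refl])
    fix m assume "m \<in> {..<n}"
    thus "r m * ((d m)\<^sup>2 * ln (d m)) = (r m * d m)\<^sup>2 / r m * (ln (r m * d m) - ln (r m))"
      using scaled_ln_diff(2)[of "r m" "d m" 1] r[of m] d[of m] by simp
  qed
  also have "\<dots> \<le> (\<Sum>ij\<in>{..<n} \<times> {..<n}. (?p ij)\<^sup>2 / ?q ij * (ln (?p ij) - ln (?q ij)))"
  proof (rule classical_square_log_antimono)
    show "(\<Sum>ij\<in>{..<n} \<times> {..<n}. (?p ij)\<^sup>2 / ?q ij) = (\<Sum>m<n. (r m * d m)\<^sup>2 / r m)"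
      using total unfolding C_def[symmetric] r_def[symmetric] sum.cartesian_product
      by (simp add: case_prod_beta cancel)
  next
    fix t :: real assume "0 < t"
    from quasi_entropy_reverse_test[of n U V G a b t d, OF U V G a b' this d A B]
    show "(\<Sum>ij\<in>{..<n} \<times> {..<n}. (?p ij)\<^sup>2 / (?p ij + t * ?q ij)) \<le> (\<Sum>m<n. (r m * d m)\<^sup>2 / (r m * d m + t * r m))"
      unfolding quasi_entropy_eq_classical C_def[symmetric] r_def[symmetric] scale
      by (simp add: case_prod_beta)
  qed (use a b b' d r in \<open>force split: prod.splits\<close>)+
  also have "\<dots> = (\<Sum>i<n. \<Sum>j<n. ?c i j * ((a i)\<^sup>2 / b j * (ln (a i) - ln (b j))))"
    unfolding sum.cartesian_product
  proof (rule sum.cong[OF refl])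
    fix ij assume "ij \<in> {..<n} \<times> {..<n}"
    then obtain i j where ij: "ij = (i, j)" "i < n" "j < n" by auto
    show "(?p ij)\<^sup>2 / ?q ij * (ln (?p ij) - ln (?q ij))
        = (case ij of (i, j) \<Rightarrow> ?c i j * ((a i)\<^sup>2 / b j * (ln (a i) - ln (b j))))"
      using scaled_ln_diff(2)[of "?c i j" "a i" "b j"] a[OF ij(2)] b[OF ij(3)] ij(1) by simp
  qed
  finally show ?thesis unfolding C_def r_def .
qed

text \<open>Monotonicity of the relative entropy under the measurement in the basis of the columns of \<open>V\<close>.\<close>

lemma measured_relative_entropy_le:
  assumes U: "unitary_mat n U" and U': "unitary_mat n U'" and V: "unitary_mat n V"
    and a: "\<And>i. i < n \<Longrightarrow> 0 \<le> a i" and b: "\<And>i. i < n \<Longrightarrow> 0 \<le> b i"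
    and supp: "\<And>i j. i < n \<Longrightarrow> j < n \<Longrightarrow> b j = 0 \<Longrightarrow> (mat_adjoint U * U') $$ (i, j) = 0 \<or> a i = 0"
  defines "k \<equiv> \<lambda>j. Re ((mat_adjoint V * unitary_diag n U a * V) $$ (j, j))"
    and "q \<equiv> \<lambda>j. Re ((mat_adjoint V * unitary_diag n U' b * V) $$ (j, j))"
  assumes k0: "\<And>j. j < n \<Longrightarrow> q j = 0 \<Longrightarrow> k j = 0"
  shows "(\<Sum>j<n. k j * (ln (k j) - ln (q j))) \<le> relative_entropy n a b (mat_adjoint U * U')"
proof -
  define C where "C = mat_adjoint U * U'"
  let ?c = "\<lambda>i j. (cmod (C $$ (i, j)))\<^sup>2"
  let ?p = "\<lambda>ij. case ij of (i, j) \<Rightarrow> ?c i j * a i" and ?q = "\<lambda>ij. case ij of (i, j) \<Rightarrow> ?c i j * b j"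
  have supp': "C $$ (i, j) = 0" if "i < n" "j < n" "b j = 0" "a i \<noteq> 0" for i j
    using supp[OF that(1-3)] that(4) by (simp add: C_def)
  note cU = unitary_carrier[OF U] and cU' = unitary_carrier[OF U'] and cV = unitary_carrier[OF V]
  have k: "k j = (\<Sum>i<n. a i * (cmod ((mat_adjoint V * U) $$ (j, i)))\<^sup>2)" if "j < n" for j
    unfolding k_def unitary_diag_sandwich'[OF cV(1) cU(1)]
      unitary_diag_diagonal_index[OF mult_carrier_mat[OF cV(2) cU(1)] that] by (rule Re_complex_of_real)
  have q: "q j = (\<Sum>i<n. b i * (cmod ((mat_adjoint V * U') $$ (j, i)))\<^sup>2)" if "j < n" for j
    unfolding q_def unitary_diag_sandwich'[OF cV(1) cU'(1)]
      unitary_diag_diagonal_index[OF mult_carrier_mat[OF cV(2) cU'(1)] that] by (rule Re_complex_of_real)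
  have "(\<Sum>j<n. k j) = Re (mat_trace (unitary_diag n V (\<lambda>_. 1) * unitary_diag n U a))"
    unfolding mat_trace_unitary_diag_mult[OF cV(1) unitary_diag_carrier[OF cU(1)]]
    by (simp add: k_def del: index_mult_mat(1))
  also have "unitary_diag n V (\<lambda>_. 1) * unitary_diag n U a = unitary_diag n U a"
    unfolding unitary_diag_one[OF cV(1)]
    using V unitary_diag_carrier[OF cU(1), of a] by (simp add: unitary_mat_def)
  also have "Re (mat_trace (unitary_diag n U a)) = (\<Sum>ij\<in>{..<n} \<times> {..<n}. ?p ij)"
    unfolding mat_trace_unitary_diag_right[OF U U'] C_def sum.cartesian_product by simp
  finally have total: "(\<Sum>j<n. k j) = (\<Sum>ij\<in>{..<n} \<times> {..<n}. ?p ij)" .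
  have "(\<Sum>j<n. k j * (ln (k j) - ln (q j))) \<le> (\<Sum>ij\<in>{..<n} \<times> {..<n}. ?p ij * (ln (?p ij) - ln (?q ij)))"
  proof (rule classical_relative_entropy_mono)
    fix t :: real assume t: "0 < t"
    show "(\<Sum>j<n. (k j)\<^sup>2 / (k j + t * q j)) \<le> (\<Sum>ij\<in>{..<n} \<times> {..<n}. (?p ij)\<^sup>2 / (?p ij + t * ?q ij))"
      using quasi_entropy_measured[of n U U' V a b t, OF U U' V a b t]
      unfolding quasi_entropy_eq_classical C_def[symmetric] k_def q_def
      by (simp add: case_prod_beta del: index_mult_mat(1))
  qed (use a b k q k0 total supp' in \<open>auto intro!: sum_nonneg split: prod.splits\<close>)
  also have "\<dots> = relative_entropy n a b C"
    using relative_entropy_eq_classical[of n a b C] a b supp[folded C_def] by (simp add: case_prod_beta)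
  finally show ?thesis unfolding C_def .
qed

text \<open>For \<open>K = A B\<^sup>-\<^sup>1 A\<close> this is \<open>Tr K (log A - log B) \<le> Tr K (log K - log A)\<close>. With \<open>k\<^sub>j\<close> and \<open>q\<^sub>j\<close> the diagonal entries of
  \<open>K\<close> and \<open>A\<^sup>2\<close> in the eigenbasis of \<open>B\<close>, monotonicity under measurement reduces
  \<open>Tr K (log K - log A\<^sup>2) + Tr K log B \<ge> 0\<close> to \<open>\<Sum> k\<^sub>j (log k\<^sub>j - log (q\<^sub>j / b\<^sub>j)) \<ge> 0\<close>. This is a classical relative entropy of
  two weights with the same total \<open>Tr K = Tr A\<^sup>2 B\<^sup>-\<^sup>1\<close>, hence nonnegative.\<close>

lemma log_difference_le_relative_entropy:
  assumes T: "unitary_mat n T" and U: "unitary_mat n U" and V: "unitary_mat n V"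
    and \<kappa>: "\<And>i. i < n \<Longrightarrow> 0 \<le> \<kappa> i" and a: "\<And>i. i < n \<Longrightarrow> 0 \<le> a i" and b: "\<And>i. i < n \<Longrightarrow> 0 < b i"
    and K: "unitary_diag n U a * unitary_diag n V (\<lambda>i. 1 / b i) * unitary_diag n U a = unitary_diag n T \<kappa>"
    and supp: "\<And>i j. i < n \<Longrightarrow> j < n \<Longrightarrow> a j = 0 \<Longrightarrow> (mat_adjoint T * U) $$ (i, j) = 0 \<or> \<kappa> i = 0"
  shows "Re (mat_trace (unitary_diag n T \<kappa> * unitary_diag n U (\<lambda>i. ln (a i))))
      - Re (mat_trace (unitary_diag n T \<kappa> * unitary_diag n V (\<lambda>i. ln (b i))))
    \<le> relative_entropy n \<kappa> a (mat_adjoint T * U)"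
proof -
  note cT = unitary_carrier[OF T] and cU = unitary_carrier[OF U] and cV = unitary_carrier[OF V]
  let ?A = "unitary_diag n U a" and ?E = "unitary_diag n V (\<lambda>i. 1 / b i)" and ?K = "unitary_diag n T \<kappa>"
  let ?Q = "unitary_diag n U (\<lambda>i. a i * a i)"
  define C where "C = mat_adjoint T * U"
  have A: "?A \<in> carrier_mat n n" and E: "?E \<in> carrier_mat n n" and cK: "?K \<in> carrier_mat n n"
    and Q: "?Q \<in> carrier_mat n n"
    by (intro unitary_diag_carrier cT cU cV)+
  have QA: "?Q = ?A * ?A" by (rule unitary_diag_mult[OF U, symmetric])
  define k where "k j = Re ((mat_adjoint V * ?K * V) $$ (j, j))" for j
  define q where "q j = Re ((mat_adjoint V * ?Q * V) $$ (j, j))" for j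
  have tr_V: "Re (mat_trace (M * unitary_diag n V g)) = (\<Sum>j<n. g j * Re ((mat_adjoint V * M * V) $$ (j, j)))"
    if M: "M \<in> carrier_mat n n" for M g
    unfolding mat_trace_comm[OF M unitary_diag_carrier[OF cV(1)]] mat_trace_unitary_diag_mult[OF cV(1) M]
    by (simp del: index_mult_mat(1))
  have q: "q j = (\<Sum>l<n. (cmod ((?A * V) $$ (l, j)))\<^sup>2)" if j: "j < n" for j
    using sandwich_square_index[OF cV(1) A j] unfolding unitary_diag_adjoint[OF cU(1)] q_def QA by simp
  have k0: "k j = 0" if j: "j < n" and qj: "q j = 0" for j
  proof -
    have AV: "(?A * V) $$ (l, j) = 0" if "l < n" for l
      using qj that unfolding q[OF j] by (simp add: sum_nonneg_eq_0_iff del: index_mult_mat(1))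
    have "mat_adjoint V * ?K * V = (mat_adjoint V * ?A * ?E) * (?A * V)"
      unfolding K[symmetric] by (simp only: assoc_mult_mat[of _ n n _ n _ n] mult_carrier_mat[of _ n n _ n] A E cV)
    moreover have "((mat_adjoint V * ?A * ?E) * (?A * V)) $$ (j, j)
        = (\<Sum>l<n. (mat_adjoint V * ?A * ?E) $$ (j, l) * (?A * V) $$ (l, j))"
      by (rule mat_mult_index[OF mult_carrier_mat[OF mult_carrier_mat[OF cV(2) A] E] mult_carrier_mat[OF A cV(1)] j j])
    ultimately show ?thesis unfolding k_def by (simp add: AV del: index_mult_mat(1))
  qed
  have sum_k: "(\<Sum>j<n. k j) = Re (mat_trace ?K)"
  proof -
    have "unitary_diag n V (\<lambda>_. 1) = 1\<^sub>m n"
      unfolding unitary_diag_one[OF cV(1)] using V by (simp add: unitary_mat_def)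
    thus ?thesis using tr_V[OF cK, of "\<lambda>_. 1"] cK by (simp add: k_def del: index_mult_mat(1))
  qed
  have "mat_trace ?K = mat_trace (?A * (?E * ?A))"
    unfolding K[symmetric] by (simp only: assoc_mult_mat[OF A E A])
  also have "\<dots> = mat_trace (?E * ?A * ?A)"
    by (rule mat_trace_comm[OF A mult_carrier_mat[OF E A]])
  also have "\<dots> = mat_trace (?E * ?Q)" unfolding QA by (simp only: assoc_mult_mat[OF E A A])
  also have "\<dots> = mat_trace (?Q * ?E)" by (rule mat_trace_comm[OF E Q])
  finally have sum_q: "(\<Sum>j<n. q j / b j) = Re (mat_trace ?K)"
    using tr_V[OF Q, of "\<lambda>i. 1 / b i"] by (simp add: q_def)
  have "0 \<le> (\<Sum>j<n. k j * (ln (k j) - ln (q j) + ln (b j)))"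
  proof -
    \<comment> \<open>Termwise \<open>x log (x / y) \<ge> x - y\<close> with \<open>x = k\<^sub>j\<close> and \<open>y = q\<^sub>j / b\<^sub>j\<close>.\<close>
    have "0 = (\<Sum>j<n. k j - q j / b j)" using sum_k sum_q by (simp add: sum_subtractf)
    also have "\<dots> \<le> (\<Sum>j<n. k j * (ln (k j) - ln (q j) + ln (b j)))"
    proof (rule sum_mono)
      fix j assume "j \<in> {..<n}"
      hence j: "j < n" by simp
      have qj: "0 \<le> q j" unfolding q[OF j] by (intro sum_nonneg) simp
      have "complex_of_real (k j) = complex_of_real (\<Sum>i<n. \<kappa> i * (cmod ((mat_adjoint V * T) $$ (j, i)))\<^sup>2)"
        unfolding k_def unitary_diag_sandwich'[OF cV(1) cT(1)]
          unitary_diag_diagonal_index[OF mult_carrier_mat[OF cV(2) cT(1)] j] by simp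
      hence kj: "0 \<le> k j" unfolding of_real_eq_iff using \<kappa> by (auto intro!: sum_nonneg)
      show "k j - q j / b j \<le> k j * (ln (k j) - ln (q j) + ln (b j))"
      proof (cases "k j = 0")
        case True
        thus ?thesis using qj b[OF j] by (simp add: divide_nonneg_pos)
      next
        case False
        hence pos: "0 < k j" "0 < q j" "0 < b j" using kj qj k0[OF j] b[OF j] by force+
        have "ln (q j / b j / k j) \<le> q j / b j / k j - 1" using pos by (intro ln_le_minus_one) simp
        moreover have "ln (q j / b j / k j) = ln (q j) - ln (b j) - ln (k j)" using pos by (simp add: ln_div ln_mult)
        ultimately have "k j * (1 - q j / b j / k j) \<le> k j * (ln (k j) - ln (q j) + ln (b j))"
          using pos by (intro mult_left_mono) auto
        thus ?thesis using pos by (simp add: right_diff_distrib)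
      qed
    qed
    finally show ?thesis .
  qed
  hence "- Re (mat_trace (?K * unitary_diag n V (\<lambda>i. ln (b i)))) \<le> (\<Sum>j<n. k j * (ln (k j) - ln (q j)))"
    unfolding tr_V[OF cK] k_def[symmetric] by (simp add: distrib_left sum.distrib mult.commute)
  also have "\<dots> \<le> relative_entropy n \<kappa> (\<lambda>i. a i * a i) C"
    unfolding k_def q_def C_def
    by (rule measured_relative_entropy_le[OF T U V])
      (use \<kappa> a supp k0 in \<open>auto simp: k_def q_def simp del: index_mult_mat(1)\<close>)
  also have "\<dots> = relative_entropy n \<kappa> a C
      - Re (mat_trace (?K * unitary_diag n U (\<lambda>i. ln (a i))))"
  proof -
    have "ln (a j * a j) = ln (a j) + ln (a j)" if "j < n" for j
      using a[OF that] by (cases "a j = 0") (simp_all add: ln_mult)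
    hence "relative_entropy n \<kappa> (\<lambda>i. a i * a i) C
        = (\<Sum>i<n. \<Sum>j<n. (cmod (C $$ (i, j)))\<^sup>2 * \<kappa> i * (ln (\<kappa> i) - ln (a j))
            - (cmod (C $$ (i, j)))\<^sup>2 * \<kappa> i * ln (a j))"
      unfolding relative_entropy_def by (intro sum.cong refl) (simp add: algebra_simps)
    also have "\<dots> = relative_entropy n \<kappa> a C - (\<Sum>i<n. \<Sum>j<n. (cmod (C $$ (i, j)))\<^sup>2 * \<kappa> i * ln (a j))"
      unfolding relative_entropy_def by (simp add: sum_subtractf)
    also have "(\<Sum>i<n. \<Sum>j<n. (cmod (C $$ (i, j)))\<^sup>2 * \<kappa> i * ln (a j))
        = Re (mat_trace (?K * unitary_diag n U (\<lambda>i. ln (a i))))"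
      unfolding mat_trace_unitary_diag_pair[OF cT(1) cU(1)] C_def[symmetric] by simp
    finally show ?thesis .
  qed
  finally show ?thesis unfolding C_def by simp
qed

text \<open>If \<open>K = M A\<close>, the kernel of \<open>A\<close> lies in that of \<open>K\<close>; this is the same fact in terms of eigenbases.\<close>

lemma overlap_zero_of_kernel_subset:
  assumes T: "unitary_mat n T" and U: "unitary_mat n U" and M: "M \<in> carrier_mat n n"
    and K: "M * unitary_diag n U a = unitary_diag n T \<kappa>"
    and ij: "i < n" "j < n" and aj: "a j = 0"
  shows "(mat_adjoint T * U) $$ (i, j) = 0 \<or> \<kappa> i = 0"
proof -
  note cT = unitary_carrier[OF T] and cU = unitary_carrier[OF U]
  note c = cT cU M mat_diag_dim mult_carrier_mat[of _ n n _ n]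
  note assoc = assoc_mult_mat[of _ n n _ n _ n]
  let ?D = "\<lambda>d. mat_diag n (\<lambda>i. complex_of_real (d i))"
  have TU: "mat_adjoint T * U \<in> carrier_mat n n" by (simp only: c)
  have TMU: "mat_adjoint T * M * U \<in> carrier_mat n n" by (simp only: c)
  have "?D \<kappa> * (mat_adjoint T * U) = mat_adjoint T * (T * (?D \<kappa> * (mat_adjoint T * U)))"
    by (rule unitary_cancel(2)[OF T, symmetric]) (simp only: c)
  also have "\<dots> = mat_adjoint T * (unitary_diag n T \<kappa> * U)"
    unfolding unitary_diag_def by (simp only: assoc c)
  also have "\<dots> = mat_adjoint T * (M * (U * (?D a * (mat_adjoint U * U))))"
    unfolding K[symmetric] unfolding unitary_diag_def by (simp only: assoc c)
  also have "\<dots> = (mat_adjoint T * M * U) * ?D a"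
    using U by (simp only: unitary_mat_def right_mult_one_mat[OF mat_diag_dim] assoc c)
  finally have "(?D \<kappa> * (mat_adjoint T * U)) $$ (i, j) = ((mat_adjoint T * M * U) * ?D a) $$ (i, j)" by simp
  hence "\<kappa> i * (mat_adjoint T * U) $$ (i, j) = 0"
    using ij aj by (simp add: mat_diag_mult_left[OF TU] mat_diag_mult_right[OF TMU] del: index_mult_mat(1) assoc_mult_mat)
  thus ?thesis by auto
qed

section \<open>The chain of trace inequalities\<close>

theorem proposition7p1:
  fixes n :: nat and A B :: "complex mat"
  assumes "psd_mat n A" and "pd_mat n B"
  shows
    "mat_trace (A * mat_inv B * A * (mat_log A - mat_log B)) \<in> \<real> \<and>
     mat_trace (A * mat_inv B * A * (mat_log A - mat_log B))
       \<le> mat_trace (mat_powr A (1/2) * mat_inv B * mat_powr A (3/2) *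
            mat_log (mat_powr A (1/2) * mat_inv B * mat_powr A (1/2))) \<and>
     mat_trace (mat_powr A (1/2) * mat_inv B * mat_powr A (3/2) *
            mat_log (mat_powr A (1/2) * mat_inv B * mat_powr A (1/2)))
       = mat_trace (mat_powr B (-1/2) * (A ^\<^sub>m 2) * mat_powr B (-1/2) *
            mat_log (mat_powr B (-1/2) * A * mat_powr B (-1/2))) \<and>
     mat_trace (mat_powr B (-1/2) * (A ^\<^sub>m 2) * mat_powr B (-1/2) *
            mat_log (mat_powr B (-1/2) * A * mat_powr B (-1/2)))
       = mat_trace (mat_powr A (3/2) * mat_inv B * mat_powr A (1/2) *
            mat_log (mat_powr A (1/2) * mat_inv B * mat_powr A (1/2))) \<and>
     mat_trace (mat_powr A (3/2) * mat_inv B * mat_powr A (1/2) *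
            mat_log (mat_powr A (1/2) * mat_inv B * mat_powr A (1/2)))
       \<le> mat_trace ((A ^\<^sub>m 2) * mat_inv B * (mat_log A - mat_log B))"
proof -
  have A: "A \<in> carrier_mat n n" "mat_adjoint A = A" and B: "B \<in> carrier_mat n n" "mat_adjoint B = B"
    using assms by (auto simp: psd_mat_def pd_mat_def)
  from hermitian_diagonalizable[OF A] obtain U a where U: "unitary_mat n U" and AU: "A = unitary_diag n U a"
    by blast
  from hermitian_diagonalizable[OF B] obtain V b where V: "unitary_mat n V" and BV: "B = unitary_diag n V b"
    by blast
  note cU = unitary_carrier[OF U] and cV = unitary_carrier[OF V]
  note assoc = assoc_mult_mat[of _ n n _ n _ n]
  have a: "0 \<le> a i" if "i < n" for i using psd_eigenvalue_nonneg[OF U assms(1)[unfolded AU] that] .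
  have b: "0 < b i" if "i < n" for i using pd_eigenvalue_pos[OF V assms(2)[unfolded BV] that] .
  define R where "R = unitary_diag n U (\<lambda>i. sqrt (a i))"
  define E where "E = unitary_diag n V (\<lambda>i. 1 / b i)"
  define F where "F = unitary_diag n V (\<lambda>i. 1 / sqrt (b i))"
  define S where "S = unitary_diag n V (\<lambda>i. sqrt (b i))"
  have R: "R \<in> carrier_mat n n" and E: "E \<in> carrier_mat n n" and F: "F \<in> carrier_mat n n"
    and S: "S \<in> carrier_mat n n"
    unfolding R_def E_def F_def S_def by (intro unitary_diag_carrier cU cV)+
  note c = R E F S A(1) B(1) mult_carrier_mat[of _ n n _ n]
  have adj: "mat_adjoint R = R" "mat_adjoint F = F" "mat_adjoint S = S" "mat_adjoint E = E"
    unfolding R_def F_def S_def E_def by (intro unitary_diag_adjoint cU cV)+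
  have V1: "unitary_diag n V (\<lambda>_. 1) = 1\<^sub>m n"
    unfolding unitary_diag_one[OF cV(1)] using V by (simp add: unitary_mat_def)
  have RR: "A = R * R"
    unfolding AU R_def unitary_diag_mult[OF U] by (rule unitary_diag_cong_diag) (simp add: a)
  have FF: "E = F * F"
    unfolding E_def F_def unitary_diag_mult[OF V]
    by (rule unitary_diag_cong_diag) (simp add: less_imp_le[OF b])
  have SS: "B = S * S"
    unfolding BV S_def unitary_diag_mult[OF V] by (rule unitary_diag_cong_diag) (simp add: less_imp_le[OF b])
  have SF: "S * F = 1\<^sub>m n" "F * S = 1\<^sub>m n"
    unfolding S_def F_def unitary_diag_mult[OF V] V1[symmetric]
    by (rule unitary_diag_cong_diag, use b in force)+
  have SF': "S * (F * X) = X" "F * (S * X) = X" if X: "X \<in> carrier_mat n n" for X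
    using SF X by (simp_all only: assoc_mult_mat[OF S F X, symmetric] assoc_mult_mat[OF F S X, symmetric]
        left_mult_one_mat[OF X])
  note words = RR FF SS SF SF' assoc R F S mult_carrier_mat[of _ n n _ n] left_mult_one_mat[of _ n n]
    right_mult_one_mat[of _ n n]
  have invB: "mat_inv B = E"
  proof (rule mat_inv_eqI[OF B(1) E])
    show "B * E = 1\<^sub>m n" "E * B = 1\<^sub>m n" by (simp_all only: words)
  qed
  have A12: "mat_powr A (1/2) = R"
    unfolding AU mat_powr_unitary_diag[OF U] R_def by (rule unitary_diag_cong_diag) (simp add: a powr_half_sqrt)
  have A32: "mat_powr A (3/2) = R * A" "mat_powr A (3/2) = A * R"
  proof -
    have "a i powr (3/2) = sqrt (a i) * a i" if "i < n" for i
    proof -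
      have "a i powr (3/2) = a i powr (1/2 + 1)" by simp
      also have "\<dots> = sqrt (a i) * a i" using a[OF that] by (simp only: powr_add powr_half_sqrt powr_one)
      finally show ?thesis .
    qed
    thus "mat_powr A (3/2) = R * A" "mat_powr A (3/2) = A * R"
      unfolding AU mat_powr_unitary_diag[OF U] R_def unitary_diag_mult[OF U]
      by (auto intro!: unitary_diag_cong_diag)
  qed
  have B12: "mat_powr B (-1/2) = F"
    unfolding BV mat_powr_unitary_diag[OF V] F_def
  proof (rule unitary_diag_cong_diag)
    fix i assume "i < n"
    have "b i powr (-1/2) = b i powr (- (1/2))" by simp
    also have "\<dots> = 1 / sqrt (b i)" using b[OF \<open>i < n\<close>] by (simp only: powr_minus_divide powr_half_sqrt less_imp_le)
    finally show "b i powr (-1/2) = 1 / sqrt (b i)" .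
  qed
  have A2: "A ^\<^sub>m 2 = A * A" using A(1) by (simp add: numeral_2_eq_2)
  \<comment> \<open>The equalities in the middle: both logarithms are carried by \<open>Z = A\<^sup>1\<^sup>/\<^sup>2 B\<^sup>-\<^sup>1\<^sup>/\<^sup>2\<close>, and the words in \<open>R\<close>, \<open>F\<close>, \<open>S\<close>
    (the square roots of \<open>A\<close>, \<open>B\<^sup>-\<^sup>1\<close> and \<open>B\<close>) are compared after full expansion.\<close>
  define Z where "Z = R * F"
  have Z: "Z \<in> carrier_mat n n" unfolding Z_def by (simp only: c)
  have Z': "mat_adjoint Z = F * R" unfolding Z_def mat_adjoint_mult[OF R F] adj ..
  have cZ': "mat_adjoint Z \<in> carrier_mat n n" by (rule mat_adjoint_carrier[OF Z])
  obtain O' d where O: "unitary_mat n O'" and D: "mat_adjoint Z * Z = unitary_diag n O' d"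
    and d: "\<And>i. i < n \<Longrightarrow> 0 \<le> d i"
    using gram_diagonalizable[OF Z] by blast
  obtain P p where P: "unitary_mat n P" and C: "Z * mat_adjoint Z = unitary_diag n P p"
    using gram_diagonalizable[OF cZ'] unfolding mat_adjoint_adjoint[OF Z] by blast
  note cO = unitary_carrier[OF O] and cP = unitary_carrier[OF P]
  define lD where "lD = unitary_diag n O' (\<lambda>i. ln (d i))"
  define lC where "lC = unitary_diag n P (\<lambda>i. ln (p i))"
  have lD: "lD \<in> carrier_mat n n" and lC: "lC \<in> carrier_mat n n"
    unfolding lD_def lC_def by (intro unitary_diag_carrier cO cP)+
  have logD: "mat_log (F * A * F) = lD"
  proof -
    have "F * A * F = mat_adjoint Z * Z" unfolding Z' unfolding Z_def by (simp only: words)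
    thus ?thesis unfolding D lD_def using mat_log_unitary_diag[OF O] by simp
  qed
  have logC: "mat_log (R * E * R) = lC"
  proof -
    have "R * E * R = Z * mat_adjoint Z" unfolding Z' unfolding Z_def by (simp only: words)
    thus ?thesis unfolding C lC_def using mat_log_unitary_diag[OF P] by simp
  qed
  have "unitary_diag n P p * Z = Z * unitary_diag n O' d"
    unfolding C[symmetric] D[symmetric] by (rule assoc_mult_mat[OF Z cZ' Z])
  from functional_calculus_intertwine[OF P O Z this]
  have CZ: "lC * Z = Z * lD" unfolding lC_def lD_def .
  have "unitary_diag n O' d * mat_adjoint Z = mat_adjoint Z * unitary_diag n P p"
    unfolding C[symmetric] D[symmetric] by (rule assoc_mult_mat[OF cZ' Z cZ'])
  from functional_calculus_intertwine[OF O P cZ' this]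
  have ZC: "mat_adjoint Z * lC = lD * mat_adjoint Z" unfolding lC_def lD_def by simp
  define M where "M = (\<Sum>m<n. (\<Sum>k<n. (cmod ((S * O') $$ (k, m)))\<^sup>2) * ((d m)\<^sup>2 * ln (d m)))"

  have middle1: "mat_trace (R * E * (R * A) * lC) = mat_trace (F * (A * A) * F * lD)"
  proof -
    have "R * E * (R * A) * lC = Z * (mat_adjoint Z * (A * lC))"
      unfolding Z' unfolding Z_def by (simp only: words lC)
    also have "mat_trace \<dots> = mat_trace (mat_adjoint Z * (A * lC) * Z)"
      by (rule mat_trace_comm[of _ n n]) (simp_all only: c Z cZ' lC)
    also have "mat_adjoint Z * (A * lC) * Z = mat_adjoint Z * (A * (lC * Z))"
      by (simp only: assoc c Z cZ' lC)
    also have "\<dots> = F * (A * A) * F * lD"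
      unfolding CZ Z' unfolding Z_def by (simp only: words lD)
    finally show ?thesis .
  qed
  have middle3: "mat_trace (A * R * E * R * lC) = mat_trace (F * (A * A) * F * lD)"
  proof -
    have "A * R * E * R * lC = A * (Z * (mat_adjoint Z * lC))"
      unfolding Z' unfolding Z_def by (simp only: words lC)
    also have "\<dots> = (A * (Z * lD)) * mat_adjoint Z"
      unfolding ZC by (simp only: assoc c Z cZ' lD)
    also have "mat_trace \<dots> = mat_trace (mat_adjoint Z * (A * (Z * lD)))"
      by (rule mat_trace_comm[of _ n n]) (simp_all only: c Z cZ' lD)
    also have "mat_adjoint Z * (A * (Z * lD)) = F * (A * A) * F * lD"
      unfolding Z' unfolding Z_def by (simp only: words lD)
    finally show ?thesis .
  qed
  \<comment> \<open>Since \<open>B\<^sup>-\<^sup>1\<^sup>/\<^sup>2 A\<^sup>2 B\<^sup>-\<^sup>1\<^sup>/\<^sup>2 = D B D\<close>, the middle trace only involves the diagonal of \<open>B\<close> in the eigenbasis of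
    \<open>D\<close>.\<close>
  have D_word: "unitary_diag n O' d = F * (R * (R * F))"
    unfolding D[symmetric] Z' unfolding Z_def by (simp only: words)
  have cD: "unitary_diag n O' d \<in> carrier_mat n n" by (rule unitary_diag_carrier[OF cO(1)])
  have middle2: "mat_trace (F * (A * A) * F * lD) = complex_of_real M"
  proof -
    have "F * (A * A) * F * lD = unitary_diag n O' d * (B * (unitary_diag n O' d * lD))"
      unfolding D_word by (simp only: words lD)
    also have "mat_trace \<dots> = mat_trace (B * (unitary_diag n O' d * lD) * unitary_diag n O' d)"
      by (rule mat_trace_comm[of _ n n]) (simp_all only: c lD cD)
    also have "\<dots> = mat_trace (B * (unitary_diag n O' d * lD * unitary_diag n O' d))"
      by (simp only: assoc c lD cD)
    also have "\<dots> = mat_trace (unitary_diag n O' d * lD * unitary_diag n O' d * B)"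
      by (rule mat_trace_comm[of _ n n]) (simp_all only: c lD cD)
    also have "\<dots> = (\<Sum>m<n. complex_of_real (d m * ln (d m) * d m) * (mat_adjoint O' * (mat_adjoint S * S) * O') $$ (m, m))"
      unfolding lD_def unitary_diag_mult[OF O] mat_trace_unitary_diag_mult[OF cO(1) B(1)] adj(3) SS[symmetric] ..
    also have "\<dots> = complex_of_real M"
      unfolding M_def by (simp add: sandwich_square_index[OF cO(1) S] power2_eq_square mult_ac
          del: index_mult_mat(1) assoc_mult_mat)
    finally show ?thesis .
  qed

  \<comment> \<open>The columns of \<open>G\<close> give the simultaneous rank one decomposition of \<open>A\<close>, \<open>B\<close> and \<open>K\<close>.\<close>
  define G where "G = S * O'"
  have G: "G \<in> carrier_mat n n" unfolding G_def by (rule mult_carrier_mat[OF S cO(1)])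
  have G_diag: "unitary_diag n G e = S * unitary_diag n O' e * S" for e
    using unitary_diag_sandwich[OF S cO(1)] unfolding adj G_def by simp
  have "unitary_diag n O' (\<lambda>_. 1) = 1\<^sub>m n"
    unfolding unitary_diag_one[OF cO(1)] using O by (simp add: unitary_mat_def)
  hence B_G: "B = G * mat_adjoint G"
    unfolding unitary_diag_one[OF G, symmetric] G_diag by (simp only: words)
  have A_G: "A = unitary_diag n G d" unfolding G_diag D_word by (simp only: words)
  define K where "K = A * E * A"
  have K: "K \<in> carrier_mat n n" unfolding K_def by (simp only: c)
  have K_G: "K = unitary_diag n G (\<lambda>i. d i * d i)"
    unfolding G_diag unitary_diag_mult[OF O, symmetric] D_word K_def by (simp only: words)
  have tr_K: "mat_trace K = complex_of_real (\<Sum>m<n. (\<Sum>k<n. (cmod (G $$ (k, m)))\<^sup>2) * (d m)\<^sup>2)"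
    unfolding K_G mat_trace_unitary_diag[OF G] by (simp add: power2_eq_square mult_ac)
  have "mat_adjoint (F * A) * (F * A) = K"
    unfolding mat_adjoint_mult[OF F A(1)] adj A(2) K_def by (simp only: words)
  with gram_diagonalizable[OF mult_carrier_mat[OF F A(1)]] obtain T \<kappa> where T: "unitary_mat n T"
    and K_T: "K = unitary_diag n T \<kappa>" and \<kappa>: "\<And>i. i < n \<Longrightarrow> 0 \<le> \<kappa> i" by metis
  note cT = unitary_carrier[OF T]

  define LA where "LA = unitary_diag n U (\<lambda>i. ln (a i))"
  define LB where "LB = unitary_diag n V (\<lambda>i. ln (b i))"
  have LA: "LA \<in> carrier_mat n n" and LB: "LB \<in> carrier_mat n n"
    unfolding LA_def LB_def by (intro unitary_diag_carrier cU cV)+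
  have logs: "mat_log A = LA" "mat_log B = LB"
    unfolding AU BV LA_def LB_def by (rule mat_log_unitary_diag[OF U] mat_log_unitary_diag[OF V])+
  let ?C = "mat_adjoint U * V"

  have upper_val: "mat_trace (A * A * E * (LA - LB)) = complex_of_real
      (\<Sum>i<n. \<Sum>j<n. (cmod (?C $$ (i, j)))\<^sup>2 * ((a i)\<^sup>2 / b j * (ln (a i) - ln (b j))))"
  proof -
    have "A * A * E * (LA - LB) = A * A * E * LA - A * A * E * LB"
      by (rule mult_minus_distrib_mat[of _ n n _ n]) (simp_all only: c LA LB)
    hence "mat_trace (A * A * E * (LA - LB)) = mat_trace (A * A * E * LA) - mat_trace (A * A * E * LB)"
      by (simp only: mat_trace_minus[of _ n] c LA LB)
    also have "mat_trace (A * A * E * LA) = mat_trace (LA * (A * A * E))"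
      by (rule mat_trace_comm[of _ n n]) (simp_all only: c LA)
    also have "LA * (A * A * E) = (LA * (A * A)) * E" by (simp only: assoc c LA)
    also have "A * A * E * LB = (A * A) * (E * LB)" by (simp only: assoc c LB)
    finally show ?thesis
      unfolding LA_def LB_def E_def AU unitary_diag_mult[OF U] unitary_diag_mult[OF V]
        mat_trace_unitary_diag_pair[OF cU(1) cV(1)]
      by (simp add: sum_subtractf[symmetric] algebra_simps power2_eq_square diff_divide_distrib
          del: index_mult_mat(1) of_real_sum flip: of_real_diff)
  qed
  have upper: "M \<le> (\<Sum>i<n. \<Sum>j<n. (cmod (?C $$ (i, j)))\<^sup>2 * ((a i)\<^sup>2 / b j * (ln (a i) - ln (b j))))"
    unfolding M_def G_def[symmetric]
  proof (rule square_log_ge_reverse_test[OF U V G])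
    have "mat_trace K = mat_trace (A * (E * A))" unfolding K_def by (simp only: assoc c)
    also have "\<dots> = mat_trace (E * A * A)" by (rule mat_trace_comm[of _ n n]) (simp_all only: c)
    also have "\<dots> = mat_trace (E * (A * A))" by (simp only: assoc c)
    also have "\<dots> = mat_trace (A * A * E)" by (rule mat_trace_comm[of _ n n]) (simp_all only: c)
    also have "\<dots> = complex_of_real (\<Sum>i<n. \<Sum>j<n. (cmod (?C $$ (i, j)))\<^sup>2 * (a i)\<^sup>2 * (1 / b j))"
      unfolding AU E_def unitary_diag_mult[OF U] mat_trace_unitary_diag_pair[OF cU(1) cV(1)]
      by (simp add: power2_eq_square del: index_mult_mat(1))
    finally show "(\<Sum>i<n. \<Sum>j<n. (cmod (?C $$ (i, j)))\<^sup>2 * (a i)\<^sup>2 * (1 / b j))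
        = (\<Sum>m<n. (\<Sum>k<n. (cmod (G $$ (k, m)))\<^sup>2) * (d m)\<^sup>2)"
      unfolding tr_K of_real_eq_iff by (rule sym)
  qed (use a b d A_G AU B_G BV in auto)

  have lower_val: "mat_trace (A * E * A * (LA - LB)) = mat_trace (K * LA) - mat_trace (K * LB)"
  proof -
    have "K * (LA - LB) = K * LA - K * LB" by (rule mult_minus_distrib_mat[OF K LA LB])
    thus ?thesis unfolding K_def[symmetric]
      by (simp only: mat_trace_minus[OF mult_carrier_mat[OF K LA] mult_carrier_mat[OF K LB]])
  qed
  have lower_real: "mat_trace (K * LA) \<in> \<real>" "mat_trace (K * LB) \<in> \<real>"
    unfolding K_T LA_def LB_def mat_trace_unitary_diag_pair[OF cT(1) cU(1)]
      mat_trace_unitary_diag_pair[OF cT(1) cV(1)] by (rule Reals_of_real)+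
  have K_prod: "(A * E) * unitary_diag n U a = unitary_diag n T \<kappa>"
    unfolding K_T[symmetric] K_def AU ..
  have supp: "(mat_adjoint T * U) $$ (i, j) = 0 \<or> \<kappa> i = 0" if "i < n" "j < n" "a j = 0" for i j
    by (rule overlap_zero_of_kernel_subset[OF T U mult_carrier_mat[OF A(1) E] K_prod that])
  \<comment> \<open>Rescaling the columns by \<open>d\<^sub>m\<^sup>1\<^sup>/\<^sup>2\<close> decomposes the pair \<open>(K, A)\<close> in place of \<open>(A, B)\<close>, with the same ratios \<open>d\<^sub>m\<close>.\<close>
  define H where "H = G * mat_diag n (\<lambda>i. complex_of_real (sqrt (d i)))"
  have H: "H \<in> carrier_mat n n" unfolding H_def by (rule mult_carrier_mat[OF G mat_diag_dim])
  have H_norm: "(\<Sum>k<n. (cmod (H $$ (k, m)))\<^sup>2) = (\<Sum>k<n. (cmod (G $$ (k, m)))\<^sup>2) * d m" if "m < n" for m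
    using that d[OF that] unfolding H_def mat_diag_mult_right[OF G]
    by (simp add: norm_mult power_mult_distrib sum_distrib_right)
  have "Re (mat_trace (K * LA)) - Re (mat_trace (K * LB)) \<le> relative_entropy n \<kappa> a (mat_adjoint T * U)"
    unfolding K_T LA_def LB_def
    by (rule log_difference_le_relative_entropy[OF T U V \<kappa> a b _ supp]) (use K_prod in \<open>simp_all add: AU E_def\<close>)
  also have "\<dots> \<le> (\<Sum>m<n. (\<Sum>k<n. (cmod (H $$ (k, m)))\<^sup>2) * d m * ln (d m))"
  proof (rule relative_entropy_le_reverse_test[OF T U H \<kappa> a d _ _ supp])
    show "unitary_diag n T \<kappa> = unitary_diag n H d"
      unfolding K_T[symmetric] K_G H_def unitary_diag_scaled[OF G]
      by (rule unitary_diag_cong_diag) (use d in \<open>simp add: mult.left_commute\<close>)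
    show "unitary_diag n U a = H * mat_adjoint H"
      unfolding unitary_diag_one[OF H, symmetric] AU[symmetric] unfolding A_G H_def unitary_diag_scaled[OF G]
      by (rule unitary_diag_cong_diag) (use d in simp)
  qed
  also have "\<dots> = M"
    unfolding M_def G_def[symmetric]
  proof (rule sum.cong[OF refl])
    fix m assume "m \<in> {..<n}"
    thus "(\<Sum>k<n. (cmod (H $$ (k, m)))\<^sup>2) * d m * ln (d m)
        = (\<Sum>k<n. (cmod (G $$ (k, m)))\<^sup>2) * ((d m)\<^sup>2 * ln (d m))"
      by (simp add: H_norm power2_eq_square[of "d m"])
  qed
  finally have lower: "Re (mat_trace (K * LA) - mat_trace (K * LB)) \<le> M" by simp

  show ?thesis
    unfolding invB A12 B12 A2 logs logC logD
    using lower lower_real upper middle1 middle2 middle3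
    unfolding lower_val upper_val
    by (auto simp: A32(1) A32(2)[symmetric] less_eq_complex_def complex_is_Real_iff)
qed

end
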